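(* Let $\lambda>0$ and $a\in\mathbb{R}$ satisfy $\lambda\notin\mathcal{N}$ and $a\notin\mathcal{N}_1$. Let $k\in\mathcal{G}$ be the unique solution of the kernel problem with parameters $\lambda,a$ (see context), and let $K:L^2(0,1)\to L^2(0,1)$ be the operator $(Kv)(x)=\int_0^1k(x,y)v(y)\,dy$. Then $I-K$ is an invertible operator from $L^2(0,1)$ to $L^2(0,1)$.
   Context: $\mathbb{Z}^+=\{1,2,3,\dots\}$, $\mathcal{N}=\{j^2\pi^2+k^2\pi^2: j,k\in\mathbb{Z}^+,\ j\ne k\}$ and $\mathcal{N}_1=\{-k^4\pi^4+\lambda k^2\pi^2+j^4\pi^4-\lambda j^2\pi^2: j,k\in\mathbb{Z}^+\}$. Kernel problem (formally): $k_{xxxx}+\lambda k_{xx}-k_{yyyy}-\lambda k_{yy}+ak=a\,\delta(x-y)$ in $(0,1)\times(0,1)$, with $k(x,0)=k(x,1)=k_{yy}(x,0)=k_{yy}(x,1)=k_y(x,0)=0$ and $k(0,y)=k(1,y)=k_{xx}(1,y)=0$. Precisely: let $\mathcal{E}$ be the set of $\rho\in C^\infty([0,1]\times[0,1])$ with $\rho(0,y)=\rho(1,y)=\rho(x,0)=\rho(x,1)=0$ and $\rho_x(0,y)=\rho_{xx}(0,y)=\rho_{xx}(1,y)=\rho_{yy}(x,1)=0$ for all $x,y\in[0,1]$. Let $\mathcal{G}$ be the set of (real-valued) $k\in H^2((0,1)\times(0,1))\cap H^1_0((0,1)\times(0,1))$ such that $x\mapsto k_{xx}(x,\cdot)$ belongs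 to $C^0([0,1];L^2(0,1))$, $y\mapsto k_{yy}(\cdot,y)$ belongs to $C^0([0,1];L^2(0,1))$, and $k_{yy}(\cdot,0)=k_{yy}(\cdot,1)=0$ in $L^2(0,1)$. A function $k\in\mathcal{G}$ is a solution of the kernel problem if for every $\rho\in\mathcal{E}$ $$\int_0^1\int_0^1\big[\rho_{xxxx}+\lambda\rho_{xx}-\rho_{yyyy}-\lambda\rho_{yy}+a\rho\big](x,y)\,k(x,y)\,dx\,dy-\int_0^1a\,\rho(x,x)\,dx=0.$$ When $\lambda\notin\mathcal{N}$ and $a\notin\mathcal{N}_1$ there is exactly one solution in $\mathcal{G}$. *)

theory Defs
  imports "HOL-Analysis.Analysis"
begin

section \<open>The space \<open>L\<^sup>2(0,1)\<close>\<close>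

definition square_integrable :: "'a measure \<Rightarrow> ('a \<Rightarrow> real) \<Rightarrow> bool" where
  "square_integrable M f \<longleftrightarrow> f \<in> borel_measurable M \<and> integrable M (\<lambda>x. (f x)\<^sup>2)"

lemma square_integrable_mult:
  assumes "square_integrable M f" "square_integrable M g"
  shows "integrable M (\<lambda>x. f x * g x)"
proof (rule Bochner_Integration.integrable_bound)
  show "integrable M (\<lambda>x. (f x)\<^sup>2 + (g x)\<^sup>2)"
    using assms by (auto simp: square_integrable_def)
  show "(\<lambda>x. f x * g x) \<in> borel_measurable M"
    using assms by (auto simp: square_integrable_def)
  have "\<bar>f x * g x\<bar> \<le> (f x)\<^sup>2 + (g x)\<^sup>2" for x
  proof -
    have "2 * (\<bar>f x\<bar> * \<bar>g x\<bar>) \<le> (f x)\<^sup>2 + (g x)\<^sup>2"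
      using sum_squares_bound[of "\<bar>f x\<bar>" "\<bar>g x\<bar>"] by simp
    moreover have "0 \<le> \<bar>f x\<bar> * \<bar>g x\<bar>" by simp
    ultimately show ?thesis unfolding abs_mult by linarith
  qed
  then show "AE x in M. norm (f x * g x) \<le> norm ((f x)\<^sup>2 + (g x)\<^sup>2)"
    by (intro AE_I2) (simp add: abs_mult)
qed

lemma square_integrable_0: "square_integrable M (\<lambda>x. 0)"
  by (simp add: square_integrable_def)

lemma square_integrable_add:
  assumes "square_integrable M f" "square_integrable M g"
  shows "square_integrable M (\<lambda>x. f x + g x)"
  using assms square_integrable_mult[OF assms]
  by (auto simp: square_integrable_def power2_sum mult.assoc)

lemma square_integrable_scale:
  "square_integrable M f \<Longrightarrow> square_integrable M (\<lambda>x. c * f x)"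
  by (auto simp: square_integrable_def power_mult_distrib)

abbreviation unit_interval :: "real measure" where
  "unit_interval \<equiv> lebesgue_on {0<..<1}"

definition L2_rel :: "(real \<Rightarrow> real) \<Rightarrow> (real \<Rightarrow> real) \<Rightarrow> bool" where
  "L2_rel f g \<longleftrightarrow> square_integrable unit_interval f \<and> square_integrable unit_interval g \<and>
     (AE x in unit_interval. f x = g x)"

quotient_type L2 = "real \<Rightarrow> real" / partial: L2_rel
proof (rule part_equivpI)
  show "\<exists>f. L2_rel f f"
    by (rule exI[of _ "\<lambda>x. 0"]) (simp add: L2_rel_def square_integrable_0)
  show "symp L2_rel"
    by (rule sympI) (auto simp: L2_rel_def elim: AE_mp)
  show "transp L2_rel"
  proof (rule transpI)
    fix f g h assume "L2_rel f g" "L2_rel g h"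
    then show "L2_rel f h" unfolding L2_rel_def by (auto elim!: AE_mp)
  qed
qed

instantiation L2 :: real_vector
begin

lift_definition zero_L2 :: L2 is "\<lambda>x. 0"
  by (simp add: L2_rel_def square_integrable_0)

lift_definition plus_L2 :: "L2 \<Rightarrow> L2 \<Rightarrow> L2" is "\<lambda>f g x. f x + g x"
  by (auto simp: L2_rel_def intro: square_integrable_add elim!: AE_mp)

lift_definition scaleR_L2 :: "real \<Rightarrow> L2 \<Rightarrow> L2" is "\<lambda>c f x. c * f x"
  by (auto simp: L2_rel_def intro: square_integrable_scale elim!: AE_mp)

definition uminus_L2 :: "L2 \<Rightarrow> L2" where
  "uminus_L2 u = (- 1) *\<^sub>R u"

definition minus_L2 :: "L2 \<Rightarrow> L2 \<Rightarrow> L2" where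
  "minus_L2 u v = u + - v"

instance
proof
  fix u v w :: L2 and r s :: real
  show "u + v + w = u + (v + w)"
    by transfer (auto simp: L2_rel_def add.assoc intro: square_integrable_add)
  show "u + v = v + u"
    by transfer (auto simp: L2_rel_def add.commute intro: square_integrable_add)
  show "0 + u = u"
    by transfer (auto simp: L2_rel_def)
  show "- u + u = 0"
    unfolding uminus_L2_def by transfer (auto simp: L2_rel_def square_integrable_0)
  show "u - v = u + - v"
    by (simp add: minus_L2_def)
  show "r *\<^sub>R (u + v) = r *\<^sub>R u + r *\<^sub>R v"
    by transfer (auto simp: L2_rel_def algebra_simps
        intro!: square_integrable_add square_integrable_scale)
  show "(r + s) *\<^sub>R u = r *\<^sub>R u + s *\<^sub>R u"
    by transfer (auto simp: L2_rel_def distrib_right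
        intro: square_integrable_add square_integrable_scale)
  show "r *\<^sub>R s *\<^sub>R u = (r * s) *\<^sub>R u"
    by transfer (auto simp: L2_rel_def mult.assoc intro: square_integrable_scale)
  show "1 *\<^sub>R u = u"
    by transfer (auto simp: L2_rel_def)
qed

end

instantiation L2 :: real_inner
begin

lift_definition inner_L2 :: "L2 \<Rightarrow> L2 \<Rightarrow> real" is
  "\<lambda>f g. \<integral>x. f x * g x \<partial>unit_interval"
proof -
  fix f f' g g' assume "L2_rel f f'" "L2_rel g g'"
  then show "(\<integral>x. f x * g x \<partial>unit_interval) = (\<integral>x. f' x * g' x \<partial>unit_interval)"
    unfolding L2_rel_def
    by (intro integral_cong_AE) (auto simp: square_integrable_def elim!: AE_mp)
qed

definition norm_L2 :: "L2 \<Rightarrow> real" where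
  "norm_L2 u = sqrt (inner u u)"

definition sgn_L2 :: "L2 \<Rightarrow> L2" where
  "sgn_L2 u = u /\<^sub>R norm u"

definition dist_L2 :: "L2 \<Rightarrow> L2 \<Rightarrow> real" where
  "dist_L2 u v = norm (u - v)"

definition uniformity_L2 :: "(L2 \<times> L2) filter" where
  "uniformity_L2 = (INF e\<in>{0<..}. principal {(u, v). dist u v < e})"

definition open_L2 :: "L2 set \<Rightarrow> bool" where
  "open_L2 U \<longleftrightarrow> (\<forall>u\<in>U. eventually (\<lambda>(u', v). u' = u \<longrightarrow> v \<in> U) uniformity)"

instance
proof
  fix u v w :: L2 and r s :: real
  show "dist u v = norm (u - v)"
    by (rule dist_L2_def)
  show "sgn u = u /\<^sub>R norm u"
    by (rule sgn_L2_def)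
  show "(uniformity :: (L2 \<times> L2) filter) = (INF e\<in>{0<..}. principal {(u, v). dist u v < e})"
    by (rule uniformity_L2_def)
  show "open U \<longleftrightarrow> (\<forall>u\<in>U. eventually (\<lambda>(u', v). u' = u \<longrightarrow> v \<in> U) uniformity)" for U :: "L2 set"
    by (rule open_L2_def)
  show "inner u v = inner v u"
    by transfer (simp add: mult.commute)
  show "inner (u + v) w = inner u w + inner v w"
    by transfer (simp add: L2_rel_def distrib_right square_integrable_mult)
  show "inner (r *\<^sub>R u) v = r * inner u v"
    by transfer (simp add: mult.assoc)
  show "0 \<le> inner u u"
    by transfer simp
  show "inner u u = 0 \<longleftrightarrow> u = 0"
  proof transfer
    fix f assume "L2_rel f f"
    then have f: "square_integrable unit_interval f" by (simp add: L2_rel_def)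
    then show "(\<integral>x. f x * f x \<partial>unit_interval) = 0 \<longleftrightarrow> L2_rel f (\<lambda>x. 0)"
      using integral_nonneg_eq_0_iff_AE[OF square_integrable_mult[OF f f]]
      by (simp add: L2_rel_def square_integrable_0)
  qed
  show "norm u = sqrt (inner u u)"
    by (rule norm_L2_def)
qed

end


section \<open>Smooth functions and Sobolev spaces on the unit square\<close>

abbreviation closed_square :: "(real \<times> real) set" where
  "closed_square \<equiv> {0..1} \<times> {0..1}"

abbreviation open_square :: "(real \<times> real) set" where
  "open_square \<equiv> {0<..<1} \<times> {0<..<1}"

abbreviation unit_square :: "(real \<times> real) measure" where
  "unit_square \<equiv> lebesgue_on open_square"

text \<open>Partial derivatives are taken relative to a set, so that they are one-sided on the boundary
  of the closed square.\<close>

definition pdx :: "(real \<times> real) set \<Rightarrow> (real \<times> real \<Rightarrow> real) \<Rightarrow> real \<times> real \<Rightarrow> real" where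
  "pdx S f p = frechet_derivative f (at p within S) (1, 0)"

definition pdy :: "(real \<times> real) set \<Rightarrow> (real \<times> real \<Rightarrow> real) \<Rightarrow> real \<times> real \<Rightarrow> real" where
  "pdy S f p = frechet_derivative f (at p within S) (0, 1)"

primrec Ck_on :: "nat \<Rightarrow> (real \<times> real) set \<Rightarrow> (real \<times> real \<Rightarrow> real) \<Rightarrow> bool" where
  "Ck_on 0 S f \<longleftrightarrow> continuous_on S f"
| "Ck_on (Suc n) S f \<longleftrightarrow> f differentiable_on S \<and> Ck_on n S (pdx S f) \<and> Ck_on n S (pdy S f)"

definition smooth_on :: "(real \<times> real) set \<Rightarrow> (real \<times> real \<Rightarrow> real) \<Rightarrow> bool" where
  "smooth_on S f \<longleftrightarrow> (\<forall>n. Ck_on n S f)"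

definition test_function :: "(real \<times> real \<Rightarrow> real) \<Rightarrow> bool" where
  "test_function \<phi> \<longleftrightarrow> smooth_on UNIV \<phi> \<and>
     (\<exists>C. compact C \<and> C \<subseteq> open_square \<and> (\<forall>p. p \<notin> C \<longrightarrow> \<phi> p = 0))"

definition weak_deriv :: "nat \<Rightarrow> nat \<Rightarrow> (real \<times> real \<Rightarrow> real) \<Rightarrow> (real \<times> real \<Rightarrow> real) \<Rightarrow> bool" where
  "weak_deriv i j u g \<longleftrightarrow> square_integrable unit_square u \<and> square_integrable unit_square g \<and>
     (\<forall>\<phi>. test_function \<phi> \<longrightarrow>
        (\<integral>p. u p * ((pdx UNIV ^^ i) ((pdy UNIV ^^ j) \<phi>)) p \<partial>unit_square)
          = (-1) ^ (i + j) * (\<integral>p. g p * \<phi> p \<partial>unit_square))"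

definition sobolev :: "nat \<Rightarrow> (real \<times> real \<Rightarrow> real) \<Rightarrow> bool" where
  "sobolev m u \<longleftrightarrow> square_integrable unit_square u \<and>
     (\<forall>i j. i + j \<le> m \<longrightarrow> (\<exists>g. weak_deriv i j u g))"

text \<open>\<open>H\<^sup>1\<^sub>0\<close> is the closure of the test functions in the norm of \<open>H\<^sup>1\<close>.\<close>

definition sobolev_H10 :: "(real \<times> real \<Rightarrow> real) \<Rightarrow> bool" where
  "sobolev_H10 u \<longleftrightarrow> (\<exists>ux uy \<phi>. weak_deriv 1 0 u ux \<and> weak_deriv 0 1 u uy \<and>
     (\<forall>n. test_function (\<phi> n)) \<and>
     (\<lambda>n::nat. \<integral>p. (\<phi> n p - u p)\<^sup>2 + (pdx UNIV (\<phi> n) p - ux p)\<^sup>2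
                  + (pdy UNIV (\<phi> n) p - uy p)\<^sup>2 \<partial>unit_square) \<longlonglongrightarrow> 0)"


section \<open>The kernel problem\<close>

definition excluded_lambda :: "real set" where
  "excluded_lambda = {(real j)\<^sup>2 * pi\<^sup>2 + (real k)\<^sup>2 * pi\<^sup>2 | j k :: nat. 1 \<le> j \<and> 1 \<le> k \<and> j \<noteq> k}"

definition excluded_a :: "real \<Rightarrow> real set" where
  "excluded_a lam = {- ((real k) ^ 4 * pi ^ 4) + lam * (real k)\<^sup>2 * pi\<^sup>2
                    + (real j) ^ 4 * pi ^ 4 - lam * (real j)\<^sup>2 * pi\<^sup>2 | j k :: nat. 1 \<le> j \<and> 1 \<le> k}"

abbreviation dx :: "(real \<times> real \<Rightarrow> real) \<Rightarrow> real \<times> real \<Rightarrow> real" where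
  "dx \<equiv> pdx closed_square"

abbreviation dy :: "(real \<times> real \<Rightarrow> real) \<Rightarrow> real \<times> real \<Rightarrow> real" where
  "dy \<equiv> pdy closed_square"

definition kernel_tests :: "(real \<times> real \<Rightarrow> real) set" where
  "kernel_tests = {\<rho>. smooth_on closed_square \<rho> \<and>
     (\<forall>x\<in>{0..1}. \<forall>y\<in>{0..1}.
        \<rho> (0, y) = 0 \<and> \<rho> (1, y) = 0 \<and> \<rho> (x, 0) = 0 \<and> \<rho> (x, 1) = 0 \<and>
        dx \<rho> (0, y) = 0 \<and> dx (dx \<rho>) (0, y) = 0 \<and> dx (dx \<rho>) (1, y) = 0 \<and>
        dy (dy \<rho>) (x, 1) = 0)}"

text \<open>An element of \<open>L\<^sup>2\<close> of the square has a slice in \<open>L\<^sup>2(0,1)\<close> only at almost every point.  That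
  \<open>x \<mapsto> k\<^sub>x\<^sub>x(x,\<cdot>)\<close> is continuous into \<open>L\<^sup>2(0,1)\<close> means that it agrees almost everywhere with a
  continuous map \<open>F\<close> on \<open>[0,1]\<close>; this \<open>F\<close> is unique and provides the values at the end points.\<close>

definition has_x_slices :: "(real \<times> real \<Rightarrow> real) \<Rightarrow> (real \<Rightarrow> L2) \<Rightarrow> bool" where
  "has_x_slices g F \<longleftrightarrow> (AE x in unit_interval.
     square_integrable unit_interval (\<lambda>y. g (x, y)) \<and> F x = abs_L2 (\<lambda>y. g (x, y)))"

definition has_y_slices :: "(real \<times> real \<Rightarrow> real) \<Rightarrow> (real \<Rightarrow> L2) \<Rightarrow> bool" where
  "has_y_slices g F \<longleftrightarrow> (AE y in unit_interval.
     square_integrable unit_interval (\<lambda>x. g (x, y)) \<and> F y = abs_L2 (\<lambda>x. g (x, y)))"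

definition kernel_space :: "(real \<times> real \<Rightarrow> real) set" where
  "kernel_space = {k. sobolev 2 k \<and> sobolev_H10 k \<and>
     (\<exists>kxx F. weak_deriv 2 0 k kxx \<and> has_x_slices kxx F \<and> continuous_on {0..1} F) \<and>
     (\<exists>kyy F. weak_deriv 0 2 k kyy \<and> has_y_slices kyy F \<and> continuous_on {0..1} F \<and>
        F 0 = 0 \<and> F 1 = 0)}"

definition kernel_solution :: "real \<Rightarrow> real \<Rightarrow> (real \<times> real \<Rightarrow> real) \<Rightarrow> bool" where
  "kernel_solution lam a k \<longleftrightarrow> k \<in> kernel_space \<and>
     (\<forall>\<rho>\<in>kernel_tests.
        (\<integral>p. ((dx ^^ 4) \<rho> p + lam * (dx ^^ 2) \<rho> p - (dy ^^ 4) \<rho> p - lam * (dy ^^ 2) \<rho> p + a * \<rho> p) * k p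
           \<partial>unit_square)
        - (\<integral>x. a * \<rho> (x, x) \<partial>unit_interval) = 0)"


section \<open>Operators\<close>

text \<open>For \<open>k\<close> square integrable on the square, the function of \<open>x\<close> below is square integrable, so
  it has a class in \<open>L\<^sup>2(0,1)\<close>; the class does not depend on the representatives of \<open>k\<close> and \<open>v\<close>.\<close>

definition integral_operator :: "(real \<times> real \<Rightarrow> real) \<Rightarrow> L2 \<Rightarrow> L2" where
  "integral_operator k v = abs_L2 (\<lambda>x. \<integral>y. k (x, y) * rep_L2 v y \<partial>unit_interval)"

definition invertible_operator :: "('a::real_normed_vector \<Rightarrow> 'b::real_normed_vector) \<Rightarrow> bool" where
  "invertible_operator A \<longleftrightarrow> bounded_linear A \<and>
     (\<exists>B. bounded_linear B \<and> (\<forall>v. B (A v) = v) \<and> (\<forall>w. A (B w) = w))"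

end

(*
  Testing the kernel problem with products of sines gives the matrix of T = I - K in the sine basis:
  with frequencies n and eigenvalues mu_n = (n pi)^4 - lam (n pi)^2, it is
  T_nj = c_j n / (mu_n - mu_j + a).  Test functions need not satisfy rho_yy(x,0) = 0; testing with a
  cubic polynomial in y therefore yields one more relation, sum_j j c_j / (mu_n - mu_j + a) = 1 for
  all n, which says that T fixes the (non square summable) vector B = (n)_n.  Let w be in the kernel of
  the adjoint T' and let R be the resolvent of diag(mu_n + a) at a very negative point.  Partial
  fractions show that T' R w is <B, R w> times a small vector, so that T B = B forces <B, R w> = 0.
  Hence the kernel of T' is invariant under R, and <B, R^m w> = 0 for all m >= 1.  As R is diagonal with distinct
  positive entries, comparing dominant terms gives w = 0.  Since K is a Hilbert-Schmidt operator,
  injectivity of T' makes T invertible by the Fredholm alternative.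
*)

theory Submission
  imports Defs
begin

text \<open>The vector B is not square summable, so T B = B is not a statement inside L^2. It is
  usable only after pairing with R w: R divides by at least a multiple of n^2, and this makes the
  series of n (R w)_n absolutely convergent. This is why the adjoint is studied, and why sequences
  with summable |w_n| / n replace square summable ones. Test functions must satisfy rho_x(0,y) = 0,
  which no single sine does. Only differences of sines in x are admissible, so each factor in y
  yields its relation up to an unknown multiple of n. For the j-th sine that unknown is c_j; for the
  cubic it enters a constant C. The cubic therefore shows only that the sum over j is independent of
  n. Its value 1 comes from large n: the diagonal term is 1 - <K e_n, e_n>, which tends to 1 because
  K is Hilbert-Schmidt, and the cubic growth of the gaps between eigenvalues makes the other terms
  O(1/n). The condition on lam makes the mu_n distinct; the condition on a makes all denominators
  nonzero, and its case j = k gives that a is nonzero.\<close>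

section \<open>A Fredholm alternative\<close>

text \<open>Dimension count: the image of a basis of \<open>span B\<close> is independent and as
  large as the basis, so a vector of \<open>span B\<close> outside its span would give an
  independent set that is too large.\<close>

lemma linear_surj_on_finite_span:
  fixes f :: "'a::real_vector \<Rightarrow> 'a"
  assumes f: "linear f" and B: "finite B" and sub: "f ` span B \<subseteq> span B"
    and inj: "\<And>x. x \<in> span B \<Longrightarrow> f x = 0 \<Longrightarrow> x = 0"
  shows "f ` span B = span B"
proof -
  obtain C where C: "C \<subseteq> B" "independent C" "B \<subseteq> span C"
    by (rule real_vector.basis_exists)
  have span: "span C = span B"
    using C by (metis real_vector.span_mono real_vector.span_span subset_antisym)
  have finC: "finite C" using B C(1) by (rule rev_finite_subset)
  have "inj_on f (span C)"
    using inj f span by (simp add: linear_inj_on_iff_eq_0 real_vector.subspace_span)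
  then have ind: "independent (f ` C)" and card: "card (f ` C) = card C"
    using C(2) f linear_independent_injective_image[of f C]
    using inj_on_subset[OF _ real_vector.span_superset] by (auto intro!: card_image)
  have img: "span (f ` C) = f ` span C" by (rule linear_span_image[OF f])
  have "b \<in> span (f ` C)" if "b \<in> span C" for b
  proof (rule ccontr)
    assume b: "b \<notin> span (f ` C)"
    then have "independent (insert b (f ` C))" using ind by (rule real_vector.independent_insertI)
    moreover have "insert b (f ` C) \<subseteq> span C"
      using that sub span real_vector.span_superset[of C] by auto
    ultimately have "card (insert b (f ` C)) \<le> card C"
      using real_vector.independent_span_bound[OF finC] by blast
    moreover have "b \<notin> f ` C" using b real_vector.span_base[of b "f ` C"] by auto
    ultimately show False using card finC by simp
  qed
  then show ?thesis using img sub span by auto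
qed

text \<open>\<open>S\<close> sends y to the fixed point of the contraction x -> y + R x. Uniqueness
  of the fixed point makes \<open>S\<close> linear, and norm (S y) <= norm y + q * norm (S y) makes
  it bounded.\<close>

lemma Neumann_inverse:
  fixes R :: "'a::{real_normed_vector,complete_space} \<Rightarrow> 'a"
  assumes R: "linear R" and bound: "\<And>x. norm (R x) \<le> q * norm x" and q: "0 \<le> q" "q < 1"
  obtains S where "bounded_linear S" "\<And>y. S y - R (S y) = y"
proof -
  interpret R: linear R by fact
  have ex1: "\<exists>!x. y + R x = x" for y
  proof (rule banach_fix_type[OF q], intro allI)
    fix x z
    show "dist (y + R x) (y + R z) \<le> q * dist x z"
      using bound[of "x - z"] by (simp add: dist_norm R.diff)
  qed
  define S where "S y = (THE x. y + R x = x)" for y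
  have S: "y + R (S y) = S y" for y
    unfolding S_def by (rule theI'[OF ex1])
  have S_eqI: "S y = x" if "y + R x = x" for x y
    using ex1 S that by blast
  have "norm (S y) \<le> norm y * (1 / (1 - q))" for y
  proof -
    have "norm (S y) \<le> norm y + q * norm (S y)"
      using norm_triangle_ineq[of y "R (S y)"] bound[of "S y"] S[of y] by simp
    then show ?thesis using q by (simp add: field_simps)
  qed
  moreover have "S (x + y) = S x + S y" for x y
    using arg_cong2[OF S[of x] S[of y], of "(+)"] by (intro S_eqI) (simp add: R.add algebra_simps)
  moreover have "S (r *\<^sub>R x) = r *\<^sub>R S x" for r x
    using S[of x] by (intro S_eqI) (simp add: R.scale flip: scaleR_add_right)
  ultimately have "bounded_linear S" by (intro bounded_linear_intro)
  moreover have "S y - R (S y) = y" for y using S[of y] by (simp add: algebra_simps)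
  ultimately show thesis by (rule that)
qed

text \<open>Write K = F + R with F the finite-rank sum and R small. With S = (I - R)^-1 one has I -
  K = (I - R) (I - S F), and S F has finite rank, so the question becomes one on a
  finite-dimensional space.\<close>

lemma Fredholm_alternative:
  fixes K :: "'a::{real_inner,complete_space} \<Rightarrow> 'a" and u v :: "'i \<Rightarrow> 'a"
  assumes K: "bounded_linear K" and I: "finite I" and q: "0 \<le> q" "q < 1"
    and approx: "\<And>x. norm (K x - (\<Sum>i\<in>I. inner x (u i) *\<^sub>R v i)) \<le> q * norm x"
    and inj: "\<And>x. x - K x = 0 \<Longrightarrow> x = 0"
  shows "invertible_operator (\<lambda>x. x - K x)"
proof -
  interpret K: bounded_linear K by fact
  define F where "F x = (\<Sum>i\<in>I. inner x (u i) *\<^sub>R v i)" for x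
  have F: "linear F"
    by (auto simp: F_def intro!: linearI simp: inner_left_distrib scaleR_left_distrib sum.distrib scaleR_sum_right)
  interpret F: linear F by fact
  define R where "R x = K x - F x" for x
  have R: "linear R"
    by (auto simp: R_def intro!: linearI simp: K.add K.scale F.add F.scale algebra_simps)
  interpret R: linear R by fact
  obtain S where S: "bounded_linear S" and S_eq: "\<And>y. S y - R (S y) = y"
    using Neumann_inverse[OF R, of q] approx q by (auto simp: R_def F_def)
  interpret S: bounded_linear S by fact
  define M where "M x = S (F x)" for x
  have M_eq: "M x = (\<Sum>i\<in>I. inner x (u i) *\<^sub>R S (v i))" for x
    by (simp add: M_def F_def S.sum S.scale)
  have IM: "linear (\<lambda>x. x - M x)"
    by (auto simp: M_def intro!: linearI simp: F.add F.scale S.add S.scale algebra_simps)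
  have IK: "x - K x = (x - M x) - R (x - M x)" for x
    using S_eq[of "F x"] by (simp add: M_def R.diff) (simp add: R_def algebra_simps)
  define B where "B = (\<lambda>i. S (v i)) ` I"
  have M_span: "M x \<in> span B" for x
    unfolding M_eq B_def
    by (intro real_vector.span_sum real_vector.span_scale real_vector.span_base imageI)
  have "(\<lambda>x. x - M x) ` span B = span B"
  proof (rule linear_surj_on_finite_span[OF IM])
    show "finite B" using I by (simp add: B_def)
    show "(\<lambda>x. x - M x) ` span B \<subseteq> span B"
      using M_span by (auto intro: real_vector.span_diff)
    show "x = 0" if "x - M x = 0" for x
      using inj[of x] IK[of x] that by (simp add: R.zero)
  qed
  then have "\<exists>z. z - M z = S (v i)" if "i \<in> I" for i
    using that real_vector.span_base[of "S (v i)" B] unfolding B_def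
    by (metis (no_types, lifting) image_eqI image_iff)
  then obtain z where z: "\<And>i. i \<in> I \<Longrightarrow> z i - M (z i) = S (v i)" by metis
  \<comment> \<open>Since (I - M) z_i = S v_i, the operator I - M maps y + sum_i <y, u_i> z_i to (y
    - M y) + M y = y. So solving finitely many equations inverts I - M on the whole space.\<close>
  define G where "G y = y + (\<Sum>i\<in>I. inner y (u i) *\<^sub>R z i)" for y
  have G: "bounded_linear G"
    unfolding G_def
    by (intro bounded_linear_add bounded_linear_ident bounded_linear_sum
        bounded_linear_compose[OF bounded_linear_scaleR_left] bounded_linear_inner_left)
  have MG: "G y - M (G y) = y" for y
  proof -
    have "(\<Sum>i\<in>I. inner y (u i) *\<^sub>R z i) - M (\<Sum>i\<in>I. inner y (u i) *\<^sub>R z i)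
        = (\<Sum>i\<in>I. inner y (u i) *\<^sub>R (z i - M (z i)))"
      using linear_sum[OF IM, of "\<lambda>i. inner y (u i) *\<^sub>R z i" I] linear_cmul[OF IM] by simp
    also have "\<dots> = M y" using z by (simp add: M_eq)
    finally show ?thesis
      using linear_add[OF IM, of y "\<Sum>i\<in>I. inner y (u i) *\<^sub>R z i"] by (simp add: G_def)
  qed
  have right: "G (S y) - K (G (S y)) = y" for y
    unfolding IK MG by (rule S_eq)
  have left: "G (S (x - K x)) = x" for x
  proof -
    have "(G (S (x - K x)) - x) - K (G (S (x - K x)) - x) = 0"
      using right[of "x - K x"] by (simp add: K.diff algebra_simps)
    from inj[OF this] show ?thesis by simp
  qed
  show ?thesis
    unfolding invertible_operator_def
    using right left bounded_linear_compose[OF G S] bounded_linear_sub[OF bounded_linear_ident K]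
    by blast
qed

section \<open>Orthonormal bases and Hilbert-Schmidt operators\<close>

locale orthonormal_basis =
  fixes e :: "nat \<Rightarrow> 'a::{real_inner,complete_space}"
  assumes orthonormal: "inner (e i) (e j) = (if i = j then 1 else 0)"
    and total: "(\<And>n. inner v (e n) = 0) \<Longrightarrow> v = 0"
begin

lemma inner_partial_sum:
  "inner (\<Sum>n\<in>A. c n *\<^sub>R e n) (e m) = (if m \<in> A then c m else 0)" if "finite A"
  using that by (simp add: inner_sum_left orthonormal if_distrib sum.delta cong: if_cong)

lemma norm_partial_sum:
  "(norm (\<Sum>n\<in>A. c n *\<^sub>R e n))\<^sup>2 = (\<Sum>n\<in>A. (c n)\<^sup>2)" if "finite A"
proof -
  have "(norm (\<Sum>n\<in>A. c n *\<^sub>R e n))\<^sup>2 = (\<Sum>m\<in>A. c m * inner (\<Sum>n\<in>A. c n *\<^sub>R e n) (e m))"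
    by (simp add: power2_norm_eq_inner inner_sum_right)
  also have "\<dots> = (\<Sum>n\<in>A. (c n)\<^sup>2)"
    using that by (intro sum.cong) (auto simp: inner_partial_sum power2_eq_square)
  finally show ?thesis .
qed

lemma Bessel: "(\<Sum>n\<in>A. (inner v (e n))\<^sup>2) \<le> (norm v)\<^sup>2" if "finite A"
proof -
  let ?p = "\<Sum>n\<in>A. inner v (e n) *\<^sub>R e n"
  have "inner v ?p = (\<Sum>n\<in>A. (inner v (e n))\<^sup>2)"
    by (simp add: inner_sum_right power2_eq_square)
  then have "(norm (v - ?p))\<^sup>2 = (norm v)\<^sup>2 - (\<Sum>n\<in>A. (inner v (e n))\<^sup>2)"
    using norm_partial_sum[OF that, of "\<lambda>n. inner v (e n)"]
    by (simp add: power2_norm_eq_inner inner_diff_left inner_diff_right inner_commute)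
  then show ?thesis using zero_le_power2[of "norm (v - ?p)"] by linarith
qed

lemma summable_coeffs: "summable (\<lambda>n. (inner v (e n))\<^sup>2)"
  by (rule summableI_nonneg_bounded[where x = "(norm v)\<^sup>2"]) (simp, rule Bessel, simp)

text \<open>By Pythagoras and Bessel's inequality the partial sums are Cauchy; their limit has the
  same coefficients as \<open>v\<close> and equals it by totality.\<close>

lemma expansion: "(\<lambda>n. inner v (e n) *\<^sub>R e n) sums v"
proof -
  let ?s = "\<lambda>n. inner v (e n) *\<^sub>R e n"
  have "Cauchy (\<lambda>n. sum ?s {..<n})"
  proof (rule metric_CauchyI)
    fix r :: real assume r: "r > 0"
    obtain N where N: "\<And>m n. m \<ge> N \<Longrightarrow> norm (\<Sum>k = m..<n. (inner v (e k))\<^sup>2) < r\<^sup>2"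
      using summable_coeffs[of v] r by (metis summable_Cauchy zero_less_power)
    have *: "dist (sum ?s {..<m}) (sum ?s {..<n}) < r" if "N \<le> m" "m \<le> n" for m n
    proof -
      have "sum ?s {..<n} - sum ?s {..<m} = sum ?s {m..<n}"
        using that by (metis lessThan_atLeast0 sum_diff_nat_ivl zero_le)
      then have "(dist (sum ?s {..<m}) (sum ?s {..<n}))\<^sup>2 = (\<Sum>k = m..<n. (inner v (e k))\<^sup>2)"
        using norm_partial_sum[of "{m..<n}" "\<lambda>k. inner v (e k)"]
        by (subst dist_commute) (simp add: dist_norm)
      also have "\<dots> < r\<^sup>2" using N[OF that(1), of n] by (simp add: sum_nonneg)
      finally show ?thesis by (rule power2_less_imp_less) (use r in simp)
    qed
    show "\<exists>M. \<forall>m\<ge>M. \<forall>n\<ge>M. dist (sum ?s {..<m}) (sum ?s {..<n}) < r"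
    proof (intro exI allI impI)
      fix m n assume "N \<le> m" "N \<le> n"
      then show "dist (sum ?s {..<m}) (sum ?s {..<n}) < r"
        using *[of m n] *[of n m] by (cases "m \<le> n") (auto simp: dist_commute)
    qed
  qed
  then obtain w where w: "?s sums w"
    by (auto simp: sums_def Cauchy_convergent_iff convergent_def)
  have "inner w (e m) = inner v (e m)" for m
  proof -
    have "(\<lambda>n. inner (?s n) (e m)) sums inner w (e m)"
      by (rule bounded_linear.sums[OF bounded_linear_inner_left w])
    moreover have "(\<lambda>n. inner (?s n) (e m)) sums (inner (?s m) (e m))"
      using sums_single[of m "\<lambda>n. inner v (e n)"]
      by (simp add: orthonormal if_distrib cong: if_cong)
    ultimately show ?thesis by (metis inner_commute inner_scaleR_right mult.right_neutral orthonormal sums_unique2)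
  qed
  then have "w - v = 0" by (intro total) (simp add: inner_diff_left)
  then show ?thesis using w by simp
qed

lemma Parseval: "(\<lambda>n. inner u (e n) * inner v (e n)) sums inner u v"
  using bounded_linear.sums[OF bounded_linear_inner_right expansion[of v], of u]
  by (simp add: mult.commute)

text \<open>The n-th coordinate of K x is <x, K' e_n>. Keeping the first N coordinates leaves an
  error whose square is at most norm x ^ 2 times a tail of the series \<open>HS\<close>.\<close>

lemma Hilbert_Schmidt_approx:
  assumes adj: "\<And>x y. inner (K x) y = inner x (K' y)"
    and HS: "summable (\<lambda>n. (norm (K' (e n)))\<^sup>2)" and q: "q > 0"
  obtains N where "\<And>x. norm (K x - (\<Sum>n<N. inner x (K' (e n)) *\<^sub>R e n)) \<le> q * norm x"
proof -
  obtain N where N: "norm (\<Sum>n. (norm (K' (e (n + N))))\<^sup>2) < q\<^sup>2"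
    using suminf_exist_split[OF _ HS, of "q\<^sup>2"] q by (metis dual_order.refl zero_less_power)
  show thesis
  proof (rule that[of N])
    fix x
    let ?r = "K x - (\<Sum>n<N. inner x (K' (e n)) *\<^sub>R e n)"
    have coeff: "inner ?r (e n) = (if n < N then 0 else inner x (K' (e n)))" for n
      by (simp add: inner_diff_left inner_partial_sum adj)
    have "(\<lambda>n. inner ?r (e (n + N)) * inner ?r (e (n + N))) sums
        (inner ?r ?r - (\<Sum>n<N. inner ?r (e n) * inner ?r (e n)))"
      by (rule sums_split_initial_segment[OF Parseval])
    then have "(\<lambda>n. (inner x (K' (e (n + N))))\<^sup>2) sums (norm ?r)\<^sup>2"
      by (simp add: coeff power2_eq_square flip: power2_norm_eq_inner)
    moreover have "(\<lambda>n. (norm x)\<^sup>2 * (norm (K' (e (n + N))))\<^sup>2) sums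
        ((norm x)\<^sup>2 * (\<Sum>n. (norm (K' (e (n + N))))\<^sup>2))"
      using HS by (intro sums_mult summable_sums summable_ignore_initial_segment)
    moreover have "(inner x (K' (e (n + N))))\<^sup>2 \<le> (norm x)\<^sup>2 * (norm (K' (e (n + N))))\<^sup>2" for n
      using Cauchy_Schwarz_ineq[of x "K' (e (n + N))"] by (simp add: power2_norm_eq_inner)
    ultimately have "(norm ?r)\<^sup>2 \<le> (norm x)\<^sup>2 * (\<Sum>n. (norm (K' (e (n + N))))\<^sup>2)"
      by (meson sums_le)
    also have "\<dots> \<le> (norm x)\<^sup>2 * q\<^sup>2"
      using N by (intro mult_left_mono) auto
    finally have "(norm ?r)\<^sup>2 \<le> (q * norm x)\<^sup>2" by (simp add: power_mult_distrib mult.commute)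
    then show "norm ?r \<le> q * norm x"
      by (rule power2_le_imp_le) (use q in simp)
  qed
qed

text \<open>Injectivity is given on the adjoint side. The Fredholm alternative for K' makes I - K'
  surjective; a vector killed by I - K is orthogonal to that range, hence zero; then the alternative
  applies to K.\<close>

lemma invertible_id_minus_Hilbert_Schmidt:
  assumes K: "bounded_linear K" and K': "bounded_linear K'"
    and adj: "\<And>x y. inner (K x) y = inner x (K' y)"
    and HS: "summable (\<lambda>n. (norm (K (e n)))\<^sup>2)" "summable (\<lambda>n. (norm (K' (e n)))\<^sup>2)"
    and inj: "\<And>x. x - K' x = 0 \<Longrightarrow> x = 0"
  shows "invertible_operator (\<lambda>x. x - K x)"
proof -
  have half: "(0::real) \<le> 1/2" "(1/2::real) < 1" "(0::real) < 1/2" by auto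
  have adj': "inner (K' x) y = inner x (K y)" for x y
    by (metis adj inner_commute)
  obtain N where N: "\<And>x. norm (K x - (\<Sum>n<N. inner x (K' (e n)) *\<^sub>R e n)) \<le> 1/2 * norm x"
    using Hilbert_Schmidt_approx[OF adj HS(2) half(3)] by blast
  obtain N' where N': "\<And>x. norm (K' x - (\<Sum>n<N'. inner x (K (e n)) *\<^sub>R e n)) \<le> 1/2 * norm x"
    using Hilbert_Schmidt_approx[OF adj' HS(1) half(3)] by blast
  have "invertible_operator (\<lambda>x. x - K' x)"
    by (rule Fredholm_alternative[OF K' _ half(1,2) N' inj]) auto
  then obtain B where B: "\<And>w. B w - K' (B w) = w" by (auto simp: invertible_operator_def)
  have "x = 0" if "x - K x = 0" for x
  proof -
    have "inner x w = 0" for w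
      using adj[of x "B w"] B[of w] that
      by (metis eq_iff_diff_eq_0 inner_diff_right)
    then show ?thesis by (metis inner_eq_zero_iff)
  qed
  then show ?thesis
    by (intro Fredholm_alternative[OF K _ half(1,2) N]) auto
qed

end

section \<open>Systems of Cauchy type\<close>

text \<open>Fubini for an absolutely convergent double series. Unordered sums
  (\<open>summable_on\<close>) carry out the exchange, and absolute convergence identifies them with
  the ordered ones.\<close>

lemma sums_swap:
  fixes f :: "nat \<Rightarrow> nat \<Rightarrow> real"
  assumes rows: "\<And>n. summable (\<lambda>j. \<bar>f n j\<bar>)" and total: "summable (\<lambda>n. \<Sum>j. \<bar>f n j\<bar>)"
  shows "(\<lambda>j. \<Sum>n. f n j) sums (\<Sum>n. \<Sum>j. f n j)"
proof -
  have infsum_eq: "infsum g UNIV = suminf g" if "summable (\<lambda>n. \<bar>g n\<bar>)" for g :: "nat \<Rightarrow> real"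
    using that has_sum_imp_sums[OF has_sum_infsum[OF norm_summable_imp_summable_on[of g]]]
    by (simp add: sums_iff)
  have rows_on: "(\<lambda>j. \<bar>f n j\<bar>) summable_on UNIV" for n
    using rows by (intro norm_summable_imp_summable_on) simp
  have row: "(\<Sum>\<^sub>\<infinity>j. \<bar>f n j\<bar>) = (\<Sum>j. \<bar>f n j\<bar>)" for n
    using rows by (intro infsum_eq) simp
  have row_nonneg: "0 \<le> (\<Sum>j. \<bar>f n j\<bar>)" for n
    using rows by (intro suminf_nonneg) auto
  have "(\<lambda>n. \<Sum>j. \<bar>f n j\<bar>) summable_on UNIV"
    using total row_nonneg by (intro norm_summable_imp_summable_on) simp
  then have "(\<lambda>p. norm (case p of (n, j) \<Rightarrow> f n j)) summable_on UNIV \<times> UNIV"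
    using rows_on row_nonneg by (subst Infinite_Sum.abs_summable_on_Sigma_iff) (simp add: row)
  then have abs: "(\<lambda>(n, j). f n j) summable_on UNIV \<times> UNIV"
    by (rule abs_summable_summable)
  have "(\<lambda>(j, n). f n j) summable_on UNIV \<times> UNIV"
    using abs by (subst (asm) product_swap[symmetric], subst (asm) summable_on_reindex)
      (simp_all add: o_def case_prod_beta')
  then have cols: "(\<lambda>j. \<Sum>\<^sub>\<infinity>n. f n j) summable_on UNIV"
    using summable_on_Sigma_banach[of "\<lambda>j n. f n j" UNIV "\<lambda>_. UNIV"] by simp
  have col: "(\<Sum>\<^sub>\<infinity>n. f n j) = (\<Sum>n. f n j)" for j
  proof (rule infsum_eq, rule summable_comparison_test'[OF total])
    fix n
    show "norm \<bar>f n j\<bar> \<le> (\<Sum>j. \<bar>f n j\<bar>)"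
      using sum_le_suminf[OF rows, of "{j}"] by simp
  qed
  have "summable (\<lambda>n. \<bar>\<Sum>j. f n j\<bar>)"
    by (rule summable_comparison_test'[OF total]) (simp add: summable_rabs rows)
  then have "(\<Sum>\<^sub>\<infinity>n. \<Sum>\<^sub>\<infinity>j. f n j) = (\<Sum>n. \<Sum>j. f n j)"
    by (simp add: infsum_eq rows)
  then show ?thesis
    using has_sum_imp_sums[OF has_sum_infsum[OF cols]] infsum_swap_banach[OF abs]
    by (simp add: col)
qed

text \<open>Let \<open>p\<close> maximize r among the indices with nonzero coefficient. Dividing the
  m-th sum by r p ^ m and letting m grow leaves b p, because injectivity of \<open>r\<close> makes
  every other ratio smaller than 1. The set \<open>A\<close> keeps only the k with r n <= r k; it is
  finite since \<open>r\<close> tends to 0, so the maximum exists.\<close>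

lemma power_sums_eq_0:
  fixes b r :: "nat \<Rightarrow> real"
  assumes b: "summable (\<lambda>n. \<bar>b n\<bar>)" and r_pos: "\<And>n. r n > 0" and r_lim: "r \<longlonglongrightarrow> 0"
    and r_inj: "inj r" and sums: "\<And>m. (\<lambda>n. b n * r n ^ m) sums 0"
  shows "b n = 0"
proof (rule ccontr)
  assume bn: "b n \<noteq> 0"
  define A where "A = {k. b k \<noteq> 0 \<and> r n \<le> r k}"
  have "\<forall>\<^sub>F k in sequentially. r k < r n"
    using order_tendstoD(2)[OF r_lim r_pos] .
  then obtain N where "\<And>k. k \<ge> N \<Longrightarrow> r k < r n" by (auto simp: eventually_sequentially)
  then have "A \<subseteq> {..<N}" by (force simp: A_def not_le)
  then have "finite A" by (rule finite_subset) simp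
  moreover have "n \<in> A" using bn by (simp add: A_def)
  ultimately obtain p where p: "p \<in> A" "\<And>k. k \<in> A \<Longrightarrow> r k \<le> r p"
    using Max_in[of "r ` A"] Max_ge[of "r ` A"] by (metis (no_types) empty_iff finite_imageI image_eqI imageE image_is_empty)
  have le: "r k \<le> r p" if "b k \<noteq> 0" for k
    using p that by (force simp: A_def)
  have "(\<lambda>m. b k * (r k / r p) ^ m) \<longlonglongrightarrow> (if k = p then b p else 0)" for k
  proof (cases "b k = 0 \<or> k = p")
    case False
    then have "r k < r p" using le[of k] r_inj by (metis injD order_le_less)
    then have "(\<lambda>m. (r k / r p) ^ m) \<longlonglongrightarrow> 0"
      using r_pos[of k] r_pos[of p] by (intro LIMSEQ_power_zero) simp
    then show ?thesis using False tendsto_mult_right_zero by auto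
  qed (use r_pos[of p] in auto)
  moreover have "norm (b k * (r k / r p) ^ m) \<le> \<bar>b k\<bar>" for k m
  proof (cases "b k = 0")
    case False
    then have "(r k / r p) ^ m \<le> 1"
      using le[of k] r_pos[of k] r_pos[of p] by (intro power_le_one) auto
    then show ?thesis
      using r_pos[of k] r_pos[of p] by (simp add: abs_mult power_abs mult_left_le)
  qed simp
  ultimately have lim: "(\<lambda>m. \<Sum>k. b k * (r k / r p) ^ m) \<longlonglongrightarrow> (\<Sum>k. if k = p then b p else 0)"
    using tannerys_theorem[of "\<lambda>k m. b k * (r k / r p) ^ m" "\<lambda>k. if k = p then b p else 0"
        sequentially "\<lambda>k. \<bar>b k\<bar>"] b by (simp add: always_eventually)
  have "(\<lambda>k. b k * (r k / r p) ^ m) sums 0" for m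
    using sums_divide[OF sums[of m], of "r p ^ m"] by (simp add: power_divide)
  then have "(\<Sum>k. b k * (r k / r p) ^ m) = 0" for m by (simp add: sums_iff)
  moreover have "(\<Sum>k. if k = p then b p else 0) = b p"
    using sums_single[of p "\<lambda>_. b p"] by (simp add: sums_iff)
  ultimately have "b p = 0"
    using lim by (simp add: LIMSEQ_const_iff)
  then show False using p by (simp add: A_def)
qed

section \<open>Eigenvalues of the sine modes and the gaps between them\<close>

definition freq :: "nat \<Rightarrow> real" where
  "freq n = real (Suc n)"

lemma freq_pos: "freq n > 0" and freq_ge_1: "freq n \<ge> 1" and freq_eq_iff: "freq n = freq j \<longleftrightarrow> n = j"
  by (auto simp: freq_def)

lemma sums_inverse_freq_squared: "(\<lambda>n. 1 / (freq n)\<^sup>2) sums (pi\<^sup>2 / 6)"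
  using inverse_squares_sums by (simp add: freq_def add.commute)

lemma freq_at_top: "filterlim freq at_top sequentially"
  unfolding freq_def by (rule filterlim_compose[OF filterlim_real_sequentially filterlim_Suc])

text \<open>The eigenvalue of d^4/dx^4 + lam d^2/dx^2 at sin (freq n pi x).\<close>

definition eigval :: "real \<Rightarrow> nat \<Rightarrow> real" where
  "eigval lam n = freq n ^ 4 * pi ^ 4 - lam * (freq n)\<^sup>2 * pi\<^sup>2"

text \<open>With z = (freq n)^2 the threshold for s is where the discriminant of pi^4 z^2 - (lam
  pi^2 + L) z + s becomes nonpositive.\<close>

lemma eigval_shift_lower:
  assumes "s \<ge> (lam * pi\<^sup>2 + L)\<^sup>2 / (4 * pi ^ 4)"
  shows "eigval lam n + s \<ge> L * (freq n)\<^sup>2"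
proof -
  have "0 \<le> (pi\<^sup>2 * (freq n)\<^sup>2 - (lam * pi\<^sup>2 + L) / (2 * pi\<^sup>2))\<^sup>2" by simp
  also have "\<dots> = pi ^ 4 * freq n ^ 4 - (lam * pi\<^sup>2 + L) * (freq n)\<^sup>2
      + (lam * pi\<^sup>2 + L)\<^sup>2 / (4 * pi ^ 4)"
    by (simp add: power2_diff power_mult_distrib power_divide flip: power_mult)
  finally show ?thesis using assms by (simp add: eigval_def algebra_simps)
qed

locale nonresonant =
  fixes lam a :: real
  assumes lam_pos: "lam > 0" and lam: "lam \<notin> excluded_lambda" and a: "a \<notin> excluded_a lam"
begin

abbreviation "\<mu> \<equiv> eigval lam"

text \<open>With x and y the two frequencies, the difference of the eigenvalues factors as pi^2 (x^2
  - y^2) ((x^2 + y^2) pi^2 - lam). For x other than y the last factor vanishes only at an excluded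
  lam.\<close>

lemma eigval_inj: "\<mu> n = \<mu> j \<longleftrightarrow> n = j"
proof
  assume "\<mu> n = \<mu> j"
  then have "pi\<^sup>2 * (((freq n)\<^sup>2 - (freq j)\<^sup>2) * (((freq n)\<^sup>2 + (freq j)\<^sup>2) * pi\<^sup>2 - lam)) = 0"
    by (simp add: eigval_def algebra_simps power2_eq_square power4_eq_xxxx)
  moreover have "((freq n)\<^sup>2 + (freq j)\<^sup>2) * pi\<^sup>2 \<noteq> lam" if "n \<noteq> j"
  proof
    assume "((freq n)\<^sup>2 + (freq j)\<^sup>2) * pi\<^sup>2 = lam"
    then have "lam \<in> excluded_lambda"
      unfolding excluded_lambda_def freq_def using that
      by (intro CollectI exI[of _ "Suc n"] exI[of _ "Suc j"]) (simp add: distrib_right)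
    then show False using lam by simp
  qed
  ultimately show "n = j"
    using freq_pos[of n] freq_pos[of j] by (auto simp: freq_eq_iff power2_eq_iff)
qed simp

lemma nonzero: "\<mu> n - \<mu> j + a \<noteq> 0"
proof
  assume "\<mu> n - \<mu> j + a = 0"
  then have "a = - (freq n ^ 4 * pi ^ 4) + lam * (freq n)\<^sup>2 * pi\<^sup>2
      + freq j ^ 4 * pi ^ 4 - lam * (freq j)\<^sup>2 * pi\<^sup>2"
    by (simp add: eigval_def algebra_simps)
  then have "a \<in> excluded_a lam"
    unfolding excluded_a_def freq_def by (intro CollectI exI[of _ "Suc n"] exI[of _ "Suc j"]) simp
  then show False using a by simp
qed

lemma a_nonzero: "a \<noteq> 0"
  using nonzero[of 0 0] by simp

text \<open>Let D be the sum of the two frequencies. In the factorization of the difference of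
  eigenvalues, |x^2 - y^2| is at least D because |x - y| >= 1, and the factor with lam is at least 3
  D^2. With pi^2 >= 9 this gives 27 D^3, enough to absorb |a| <= D^3.\<close>

lemma gap_large:
  assumes "n \<noteq> j" and D: "freq n + freq j \<ge> 1 + lam + \<bar>a\<bar>"
  shows "(freq n + freq j) ^ 3 \<le> \<bar>\<mu> n - \<mu> j + a\<bar>"
proof -
  define x y where "x = freq n" and "y = freq j"
  define D where "D = x + y"
  have xy: "x \<ge> 1" "y \<ge> 1" and D1: "D \<ge> 1" "D \<ge> lam" "D \<ge> \<bar>a\<bar>"
    using assms lam_pos freq_ge_1 by (auto simp: x_def y_def D_def)
  have pi9: "pi\<^sup>2 \<ge> 9" using pi_gt3 power_mono[of 3 pi 2] by simp
  have D2: "D\<^sup>2 \<ge> D" using D1(1) by (simp add: power2_eq_square)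
  have "\<bar>x - y\<bar> \<ge> 1" using assms(1) by (auto simp: x_def y_def freq_def)
  then have "\<bar>x - y\<bar> * D \<ge> D" using D1 by simp
  then have diff: "\<bar>x\<^sup>2 - y\<^sup>2\<bar> \<ge> D"
    using D1 by (simp add: power2_eq_square square_diff_square_factored abs_mult D_def mult.commute)
  have "x\<^sup>2 + y\<^sup>2 \<ge> D\<^sup>2 / 2"
    using sum_squares_bound[of x y] by (simp add: D_def power2_sum)
  then have "(x\<^sup>2 + y\<^sup>2) * pi\<^sup>2 \<ge> D\<^sup>2 / 2 * 9" using pi9 by (intro mult_mono) auto
  then have sum: "(x\<^sup>2 + y\<^sup>2) * pi\<^sup>2 - lam \<ge> 3 * D\<^sup>2" using D2 D1 by linarith
  have "\<mu> n - \<mu> j = pi\<^sup>2 * ((x\<^sup>2 - y\<^sup>2) * ((x\<^sup>2 + y\<^sup>2) * pi\<^sup>2 - lam))"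
    by (simp add: eigval_def x_def y_def algebra_simps power2_eq_square power4_eq_xxxx)
  then have "\<bar>\<mu> n - \<mu> j\<bar> = pi\<^sup>2 * (\<bar>x\<^sup>2 - y\<^sup>2\<bar> * \<bar>(x\<^sup>2 + y\<^sup>2) * pi\<^sup>2 - lam\<bar>)"
    by (simp add: abs_mult)
  also have "\<dots> \<ge> 9 * (D * (3 * D\<^sup>2))"
    using pi9 diff sum D1 by (intro mult_mono) auto
  finally have "\<bar>\<mu> n - \<mu> j\<bar> \<ge> 27 * D ^ 3" by (simp add: power3_eq_cube power2_eq_square)
  moreover have "D ^ 3 \<ge> D" using D1(1) self_le_power[of D 3] by simp
  ultimately show ?thesis using D1 unfolding D_def x_def y_def by linarith
qed

lemma gap:
  obtains C where "C > 0" "\<And>n j. n \<noteq> j \<Longrightarrow> 1 / \<bar>\<mu> n - \<mu> j + a\<bar> \<le> C / (freq n + freq j) ^ 3"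
proof -
  define P where "P = {(n, j). freq n + freq j < 1 + lam + \<bar>a\<bar>}"
  define h where "h = (\<lambda>(n, j). (freq n + freq j) ^ 3 / \<bar>\<mu> n - \<mu> j + a\<bar>)"
  have h_nonneg: "h p \<ge> 0" for p
    using less_imp_le[OF freq_pos] by (auto simp: h_def split: prod.split)
  obtain N :: nat where N: "1 + lam + \<bar>a\<bar> < real N" using reals_Archimedean2 by blast
  have "P \<subseteq> {..<N} \<times> {..<N}" using N by (auto simp: P_def freq_def)
  then have fin: "finite P" by (rule finite_subset) simp
  show thesis
  \<comment> \<open>The summand 1 serves the pairs outside \<open>P\<close>, where
    \<open>gap_large\<close> gives h <= 1; the finite sum serves the exceptional pairs.\<close>
  proof (rule that[of "1 + sum h P"])
    show "1 + sum h P > 0" by (simp add: add_pos_nonneg h_nonneg sum_nonneg)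
    fix n j :: nat assume nj: "n \<noteq> j"
    have pos: "\<bar>\<mu> n - \<mu> j + a\<bar> > 0" "(freq n + freq j) ^ 3 > 0"
      using nonzero freq_pos[of n] freq_pos[of j] by auto
    have "h (n, j) \<le> 1 + sum h P"
    proof (cases "(n, j) \<in> P")
      case True
      then show ?thesis using member_le_sum[of "(n, j)" P h] fin h_nonneg by fastforce
    next
      case False
      then have "h (n, j) \<le> 1"
        using gap_large[OF nj] pos by (simp add: h_def P_def)
      then show ?thesis using sum_nonneg[of P h] h_nonneg by fastforce
    qed
    then show "1 / \<bar>\<mu> n - \<mu> j + a\<bar> \<le> (1 + sum h P) / (freq n + freq j) ^ 3"
      using pos by (simp add: h_def field_simps)
  qed
qed

text \<open>With x_n = mu_n + a and y_j = mu_j this is the Cauchy matrix 1 / (x_n - y_j).\<close>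

definition entry :: "nat \<Rightarrow> nat \<Rightarrow> real" where
  "entry n j = 1 / (\<mu> n - \<mu> j + a)"

text \<open>Two ways to distribute the cubic gap. The first is summable in j and keeps one power of
  decay in n.\<close>

lemma entry_bound:
  obtains C where "C > 0" "\<And>n j. n \<noteq> j \<Longrightarrow> \<bar>entry n j\<bar> \<le> C / (freq n * (freq j)\<^sup>2)"
    "\<And>n j. n \<noteq> j \<Longrightarrow> \<bar>entry n j\<bar> \<le> C / freq n ^ 3"
proof -
  obtain C where C: "C > 0" "\<And>n j. n \<noteq> j \<Longrightarrow> 1 / \<bar>\<mu> n - \<mu> j + a\<bar> \<le> C / (freq n + freq j) ^ 3"
    using gap by metis
  have *: "\<bar>entry n j\<bar> \<le> C / z" if "n \<noteq> j" "z > 0" "z \<le> (freq n + freq j) ^ 3" for n j z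
  proof -
    have "\<bar>entry n j\<bar> \<le> C / (freq n + freq j) ^ 3"
      using C(2)[OF that(1)] by (simp add: entry_def abs_divide)
    also have "\<dots> \<le> C / z"
      using that C(1) freq_pos[of n] freq_pos[of j] by (intro divide_left_mono mult_pos_pos zero_less_power) auto
    finally show ?thesis .
  qed
  show thesis
  proof (rule that[OF C(1)])
    fix n j :: nat assume nj: "n \<noteq> j"
    have pos: "freq n > 0" "freq j > 0" by (auto simp: freq_pos)
    have "freq n * (freq j * freq j) \<le> (freq n + freq j) * ((freq n + freq j) * (freq n + freq j))"
      using pos by (intro mult_mono) auto
    then show "\<bar>entry n j\<bar> \<le> C / (freq n * (freq j)\<^sup>2)"
      using pos by (intro *[OF nj]) (auto simp: power3_eq_cube power2_eq_square mult.assoc)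
    show "\<bar>entry n j\<bar> \<le> C / freq n ^ 3"
      using pos by (intro *[OF nj] power_mono) auto
  qed
qed

end

section \<open>The Cauchy system and the sequences killed by its transpose\<close>

text \<open>\<open>sums_const\<close> encodes \<open>k\<^sub>y(x, 0) = 0\<close>, the natural boundary condition of the kernel problem that comes
  from test functions with \<open>\<rho>\<^sub>y\<^sub>y(x, 0) \<noteq> 0\<close>.\<close>

locale cauchy_system = nonresonant +
  fixes c :: "nat \<Rightarrow> real" and C :: real
  assumes c_lim: "(\<lambda>j. freq j * c j) \<longlonglongrightarrow> a"
    and sums_const: "\<And>n. (\<lambda>j. c j * ((\<mu> n + a) / freq j ^ 3 + lam * pi\<^sup>2 / freq j) * entry n j) sums C"
begin

lemma weight_bounded:
  obtains M where "M > 0" "\<And>j. \<bar>freq j * c j\<bar> \<le> M"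
  using BseqE[OF convergent_imp_Bseq[OF convergentI[OF c_lim]]] by (metis real_norm_def)

text \<open>With G = mu_n - mu_j + a and j standing for its frequency, the weight in
  \<open>sums_const\<close> equals G / j^3 + pi^4 j. The first part cancels the denominator and
  leaves a sum free of n, so the sum of j c_j / G is a constant C'. Comparison with the diagonal
  term for large n gives C' = 1.\<close>

lemma entry_sums_1: "(\<lambda>j. freq j * c j * entry n j) sums 1"
proof -
  obtain M where M: "M > 0" "\<And>j. \<bar>freq j * c j\<bar> \<le> M" using weight_bounded by metis
  obtain D where D: "D > 0" "\<And>n j. n \<noteq> j \<Longrightarrow> \<bar>entry n j\<bar> \<le> D / (freq n * (freq j)\<^sup>2)"
    using entry_bound by metis
  have inv2: "summable (\<lambda>j. 1 / (freq j)\<^sup>2)"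
    using sums_inverse_freq_squared by (rule sums_summable)
  have "summable (\<lambda>j. c j / freq j ^ 3)"
  proof (rule summable_comparison_test'[OF summable_mult[OF inv2, of M]])
    fix j
    have "\<bar>c j\<bar> \<le> M"
      using M(2)[of j] freq_ge_1[of j] mult_right_mono[of 1 "freq j" "\<bar>c j\<bar>"] by (simp add: abs_mult)
    moreover have "(freq j)\<^sup>2 \<le> freq j ^ 3" using freq_ge_1[of j] by (intro power_increasing) auto
    ultimately show "norm (c j / freq j ^ 3) \<le> M * (1 / (freq j)\<^sup>2)"
      using freq_pos[of j] by (auto simp: abs_divide intro!: frac_le)
  qed
  then obtain Z where Z: "(\<lambda>j. c j / freq j ^ 3) sums Z" by (auto simp: summable_def)
  define C' where "C' = (C - Z) / pi ^ 4"
  have sums: "(\<lambda>j. freq j * c j * entry n j) sums C'" for n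
  proof -
    have "(c j * ((\<mu> n + a) / freq j ^ 3 + lam * pi\<^sup>2 / freq j) * entry n j - c j / freq j ^ 3) / pi ^ 4
        = freq j * c j * entry n j" for j
    proof -
      define G where "G = \<mu> n - \<mu> j + a"
      have eq: "(\<mu> n + a) / freq j ^ 3 + lam * pi\<^sup>2 / freq j = G / freq j ^ 3 + pi ^ 4 * freq j"
        using freq_pos[of j]
        by (simp add: G_def eigval_def field_simps power2_eq_square power3_eq_cube power4_eq_xxxx)
      have "G \<noteq> 0" using nonzero by (simp add: G_def)
      then show ?thesis
        using freq_pos[of j] unfolding entry_def G_def[symmetric] eq by (simp add: field_simps)
    qed
    then show ?thesis
      using sums_divide[OF sums_diff[OF sums_const[of n] Z], of "pi ^ 4"] by (simp add: C'_def)
  qed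
  \<comment> \<open>At j = n the denominator is \<open>a\<close>, so the diagonal term is freq n * c
    n / a, which tends to 1 by \<open>c_lim\<close>. The remaining terms add up to O(1/n).\<close>
  have close: "\<bar>C' - freq n * c n / a\<bar> \<le> M * D * (pi\<^sup>2 / 6) / freq n" for n
  proof -
    have "(\<lambda>j. freq j * c j * entry n j - (if j = n then freq n * c n / a else 0)) sums
        (C' - freq n * c n / a)"
      using sums_single[of n "\<lambda>_. freq n * c n / a"] by (intro sums_diff sums) simp
    moreover have "(\<lambda>j. M * D / freq n * (1 / (freq j)\<^sup>2)) sums (M * D / freq n * (pi\<^sup>2 / 6))"
      by (intro sums_mult sums_inverse_freq_squared)
    moreover have "\<bar>freq j * c j * entry n j - (if j = n then freq n * c n / a else 0)\<bar>
        \<le> M * D / freq n * (1 / (freq j)\<^sup>2)" for j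
    proof (cases "j = n")
      case True
      then show ?thesis using M D freq_pos[of n] by (simp add: entry_def)
    next
      case False
      have "\<bar>freq j * c j\<bar> * \<bar>entry n j\<bar> \<le> M * (D / (freq n * (freq j)\<^sup>2))"
        using M D(2)[of n j] False by (intro mult_mono) auto
      then show ?thesis using False by (simp add: abs_mult)
    qed
    ultimately have "\<bar>C' - freq n * c n / a\<bar> \<le> M * D / freq n * (pi\<^sup>2 / 6)"
      by (metis (no_types, lifting) norm_suminf_le real_norm_def sums_iff)
    then show ?thesis by simp
  qed
  have "(\<lambda>n. C' - freq n * c n / a) \<longlonglongrightarrow> C' - a / a"
    using c_lim a_nonzero by (intro tendsto_intros) auto
  moreover have "(\<lambda>n. C' - freq n * c n / a) \<longlonglongrightarrow> 0"
  proof (rule Lim_null_comparison)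
    show "\<forall>\<^sub>F n in sequentially. norm (C' - freq n * c n / a) \<le> M * D * (pi\<^sup>2 / 6) / freq n"
      using close by simp
    show "(\<lambda>n. M * D * (pi\<^sup>2 / 6) / freq n) \<longlonglongrightarrow> 0"
      by (rule tendsto_divide_0[OF tendsto_const filterlim_at_top_imp_at_infinity[OF freq_at_top]])
  qed
  ultimately have "C' = 1" using LIMSEQ_unique a_nonzero by fastforce
  then show ?thesis using sums[of n] by simp
qed

text \<open>The second condition is T' w = 0 for the matrix c_j n / (mu_n - mu_j + a). The weight in
  the first admits every square summable sequence and suffices to make the pairing of B with the
  resolvent of w converge absolutely.\<close>

definition annihilates :: "(nat \<Rightarrow> real) \<Rightarrow> bool" where
  "annihilates w \<longleftrightarrow> summable (\<lambda>n. \<bar>w n\<bar> / freq n) \<and>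
     (\<forall>j. (\<lambda>n. w n * freq n * (c j * entry n j)) sums 0)"

text \<open>Here u = R w, and S = <B, u>. Partial fractions and T' w = 0 give (T' u)_j = - c_j S /
  (mu_j + s). Pairing with B and using T B = B yields S = - S * sum_j j c_j / (mu_j + s). The last
  sum is at most (M / L) pi^2 / 6 < 1 in absolute value, so S = 0, and then T' u = 0 as
  well.\<close>

lemma annihilates_resolvent:
  assumes w: "annihilates w" and M: "\<And>j. \<bar>freq j * c j\<bar> \<le> M" and L: "L > M * (pi\<^sup>2 / 6)"
    and s: "\<And>j. \<mu> j + s \<ge> L * (freq j)\<^sup>2" "\<And>j. \<mu> j + a + s \<ge> L * (freq j)\<^sup>2"
  defines "u \<equiv> \<lambda>n. w n / (\<mu> n + a + s)"
  shows "(\<lambda>n. freq n * u n) sums 0" "summable (\<lambda>n. \<bar>freq n * u n\<bar>)" "annihilates u"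
proof -
  have M0: "M \<ge> 0" using M[of 0] by linarith
  then have L0: "L > 0" using L by (smt (verit) mult_nonneg_nonneg zero_le_divide_iff zero_le_power2)
  have Lf: "L * (freq j)\<^sup>2 > 0" for j using L0 freq_pos[of j] by simp
  have pos: "\<mu> j + s > 0" "\<mu> j + a + s > 0" for j
    using s[of j] Lf[of j] by linarith+
  have w_summable: "summable (\<lambda>n. \<bar>w n\<bar> / freq n)"
    and w_sums: "\<And>j. (\<lambda>n. w n * freq n * (c j * entry n j)) sums 0"
    using w by (auto simp: annihilates_def)
  have u_le: "\<bar>u n\<bar> \<le> \<bar>w n\<bar> / (L * (freq n)\<^sup>2)" for n
    unfolding u_def abs_divide using pos[of n] s(2)[of n] Lf[of n]
    by (auto intro!: divide_left_mono)
  have fu_le: "\<bar>freq n * u n\<bar> \<le> 1 / L * (\<bar>w n\<bar> / freq n)" for n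
    using mult_left_mono[OF u_le[of n], of "freq n"] freq_pos[of n] L0
    by (simp add: abs_mult power2_eq_square field_simps)
  show fu_summable: "summable (\<lambda>n. \<bar>freq n * u n\<bar>)"
    by (rule summable_comparison_test'[OF summable_mult[OF w_summable, of "1 / L"]]) (use fu_le in simp)
  define S where "S = (\<Sum>n. freq n * u n)"
  have S: "(\<lambda>n. freq n * u n) sums S"
    unfolding S_def by (rule summable_sums[OF summable_rabs_cancel[OF fu_summable]])
  have u_sums: "(\<lambda>n. u n * freq n * (c j * entry n j)) sums (- c j * S / (\<mu> j + s))" for j
  proof -
    \<comment> \<open>With P = mu_j + s the denominator of u n is G + P, and 1 / (G (G + P)) = (1 /
      G - 1 / (G + P)) / P, where P does not depend on n.\<close>
    have "(w n * freq n * (c j * entry n j) - c j * (freq n * u n)) / (\<mu> j + s)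
        = u n * freq n * (c j * entry n j)" for n
    proof -
      define G where "G = \<mu> n - \<mu> j + a"
      define P where "P = \<mu> j + s"
      have *: "G \<noteq> 0" "P \<noteq> 0" "G + P \<noteq> 0" and e: "\<mu> n + a + s = G + P"
        using nonzero[of n j] pos[of j] pos(2)[of n] by (auto simp: G_def P_def algebra_simps)
      have "1 / G - 1 / (G + P) = P * (1 / (G + P) * (1 / G))"
        using * by (simp add: diff_frac_eq)
      then have key: "(1 / G - 1 / (G + P)) / P = 1 / (G + P) * (1 / G)"
        using * by simp
      have "(w n * freq n * (c j * (1 / G)) - c j * (freq n * (w n / (G + P)))) / P
          = w n * freq n * c j * ((1 / G - 1 / (G + P)) / P)"
        by (simp add: right_diff_distrib diff_divide_distrib mult_ac)
      also have "\<dots> = w n / (G + P) * freq n * (c j * (1 / G))"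
        unfolding key by simp
      finally show ?thesis
        unfolding u_def entry_def e G_def[symmetric] P_def[symmetric] .
    qed
    then show ?thesis
      using sums_divide[OF sums_diff[OF w_sums[of j] sums_mult[OF S, of "c j"]], of "\<mu> j + s"] by simp
  qed
  \<comment> \<open>Row n of this double series sums to n u_n by \<open>entry_sums_1\<close>, and
    column j sums to j (T' u)_j. Exchanging the two orders is the step <T B, u> = <B, T' u>.\<close>
  define f where "f n j = u n * freq n * (freq j * c j * entry n j)" for n j
  obtain D where D: "D > 0" "\<And>n j. n \<noteq> j \<Longrightarrow> \<bar>entry n j\<bar> \<le> D / (freq n * (freq j)\<^sup>2)"
    using entry_bound by metis
  have entry_le: "\<bar>entry n j\<bar> \<le> D * (1 / (freq j)\<^sup>2) + (if j = n then 1 / \<bar>a\<bar> else 0)" for n j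
  proof (cases "n = j")
    case True
    then show ?thesis using D(1) by (simp add: entry_def abs_divide)
  next
    case False
    have "D / (freq n * (freq j)\<^sup>2) \<le> D / (1 * (freq j)\<^sup>2)"
      using D(1) freq_ge_1[of n] freq_pos[of n] freq_pos[of j]
      by (intro divide_left_mono mult_right_mono) auto
    then show ?thesis using D(2)[OF False] False by simp
  qed
  have f_le: "\<bar>f n j\<bar> \<le> \<bar>freq n * u n\<bar> * (M * (D * (1 / (freq j)\<^sup>2) + (if j = n then 1 / \<bar>a\<bar> else 0)))" for n j
  proof -
    have "\<bar>freq j * c j\<bar> * \<bar>entry n j\<bar> \<le> M * (D * (1 / (freq j)\<^sup>2) + (if j = n then 1 / \<bar>a\<bar> else 0))"
      using M entry_le M0 by (intro mult_mono) auto
    then have "\<bar>freq n * u n\<bar> * (\<bar>freq j * c j\<bar> * \<bar>entry n j\<bar>) \<le>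
        \<bar>freq n * u n\<bar> * (M * (D * (1 / (freq j)\<^sup>2) + (if j = n then 1 / \<bar>a\<bar> else 0)))"
      by (intro mult_left_mono) auto
    then show ?thesis by (simp add: f_def abs_mult mult_ac)
  qed
  have bound_sums: "(\<lambda>j. \<bar>freq n * u n\<bar> * (M * (D * (1 / (freq j)\<^sup>2) + (if j = n then 1 / \<bar>a\<bar> else 0))))
      sums (\<bar>freq n * u n\<bar> * (M * (D * (pi\<^sup>2 / 6) + 1 / \<bar>a\<bar>)))" for n
    using sums_single[of n "\<lambda>_. 1 / \<bar>a\<bar>"]
    by (intro sums_mult sums_add sums_inverse_freq_squared) simp
  have rows: "summable (\<lambda>j. \<bar>f n j\<bar>)" for n
    by (rule summable_comparison_test'[OF sums_summable[OF bound_sums[of n]]]) (use f_le in simp)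
  have "summable (\<lambda>n. \<Sum>j. \<bar>f n j\<bar>)"
  proof (rule summable_comparison_test'[OF summable_mult2[OF fu_summable]])
    fix n
    have "(\<Sum>j. \<bar>f n j\<bar>) \<le> \<bar>freq n * u n\<bar> * (M * (D * (pi\<^sup>2 / 6) + 1 / \<bar>a\<bar>))"
      using f_le by (rule sums_le[OF _ summable_sums[OF rows] bound_sums])
    then show "norm (\<Sum>j. \<bar>f n j\<bar>) \<le> \<bar>freq n * u n\<bar> * (M * (D * (pi\<^sup>2 / 6) + 1 / \<bar>a\<bar>))"
      using rows by (simp add: suminf_nonneg)
  qed
  with rows have "(\<lambda>j. \<Sum>n. f n j) sums (\<Sum>n. \<Sum>j. f n j)"
    by (rule sums_swap)
  moreover have "(\<Sum>j. f n j) = freq n * u n" for n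
    using sums_mult[OF entry_sums_1[of n], of "u n * freq n"] by (simp add: f_def sums_iff mult.commute)
  moreover have "(\<Sum>n. f n j) = - (freq j * c j) * S / (\<mu> j + s)" for j
    using sums_mult[OF u_sums[of j], of "freq j"] by (simp add: f_def sums_iff mult_ac)
  ultimately have S_sums: "(\<lambda>j. - (freq j * c j) * S / (\<mu> j + s)) sums S"
    by (simp add: S_def)
  have "(\<lambda>j. M * \<bar>S\<bar> / L * (1 / (freq j)\<^sup>2)) sums (M * \<bar>S\<bar> / L * (pi\<^sup>2 / 6))"
    by (intro sums_mult sums_inverse_freq_squared)
  moreover have "\<bar>- (freq j * c j) * S / (\<mu> j + s)\<bar> \<le> M * \<bar>S\<bar> / L * (1 / (freq j)\<^sup>2)" for j
  proof -
    have "\<bar>freq j * c j\<bar> * \<bar>S\<bar> / (\<mu> j + s) \<le> M * \<bar>S\<bar> / (L * (freq j)\<^sup>2)"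
      using M M0 s(1)[of j] Lf[of j] by (intro frac_le mult_right_mono mult_nonneg_nonneg) auto
    then show ?thesis using pos(1)[of j] by (simp add: abs_mult abs_divide)
  qed
  ultimately have "\<bar>S\<bar> \<le> M * \<bar>S\<bar> / L * (pi\<^sup>2 / 6)"
    using S_sums by (metis (no_types, lifting) norm_suminf_le real_norm_def sums_iff)
  then have "\<bar>S\<bar> * (L - M * (pi\<^sup>2 / 6)) \<le> 0"
    using L0 by (simp add: field_simps)
  then have S0: "S = 0" using L by (simp add: mult_le_0_iff)
  then show "(\<lambda>n. freq n * u n) sums 0" using S by simp
  have "summable (\<lambda>n. \<bar>u n\<bar> / freq n)"
  proof (rule summable_comparison_test'[OF fu_summable])
    fix n
    have "\<bar>u n\<bar> / freq n \<le> \<bar>u n\<bar> / 1"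
      using freq_ge_1[of n] by (intro divide_left_mono) auto
    also have "\<bar>u n\<bar> / 1 \<le> freq n * \<bar>u n\<bar>"
      using mult_right_mono[OF freq_ge_1[of n], of "\<bar>u n\<bar>"] by simp
    finally show "norm (\<bar>u n\<bar> / freq n) \<le> \<bar>freq n * u n\<bar>"
      using freq_pos[of n] by (simp add: abs_mult)
  qed
  then show "annihilates u" using u_sums S0 by (simp add: annihilates_def)
qed

text \<open>Iterating \<open>annihilates_resolvent\<close> gives <B, R^(m+1) w> = 0 for all m. These
  are power sums in the r n with coefficients n w_n r n; the factor r n is split off because n w_n
  alone need not be summable.\<close>

lemma annihilates_imp_0:
  assumes "annihilates w"
  shows "w n = 0"
proof -
  obtain M where M: "M > 0" "\<And>j. \<bar>freq j * c j\<bar> \<le> M" using weight_bounded by metis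
  \<comment> \<open>Besides exceeding M pi^2 / 6, this is at least 1, which yields r n <= 1 / freq
    n.\<close>
  define L where "L = M * (pi\<^sup>2 / 6) + 1"
  \<comment> \<open>The fraction is the threshold of \<open>eigval_shift_lower\<close>; adding |a|
    keeps both s and a + s above it.\<close>
  define s where "s = (lam * pi\<^sup>2 + L)\<^sup>2 / (4 * pi ^ 4) + \<bar>a\<bar>"
  have L: "L > M * (pi\<^sup>2 / 6)" and L1: "L \<ge> 1" using M by (auto simp: L_def)
  have s: "\<mu> j + s \<ge> L * (freq j)\<^sup>2" "\<mu> j + a + s \<ge> L * (freq j)\<^sup>2" for j
    using eigval_shift_lower[of lam L s j] eigval_shift_lower[of lam L "a + s" j]
    by (auto simp: s_def algebra_simps)
  define r where "r n = 1 / (\<mu> n + a + s)" for n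
  have denom: "\<mu> n + a + s \<ge> freq n" for n
  proof -
    have "freq n \<le> (freq n)\<^sup>2" using freq_ge_1[of n] by (simp add: power2_eq_square)
    also have "\<dots> \<le> L * (freq n)\<^sup>2" using L1 mult_right_mono[of 1 L "(freq n)\<^sup>2"] by simp
    finally show ?thesis using s(2)[of n] by simp
  qed
  have r_pos: "r n > 0" for n
    using denom[of n] freq_pos[of n] unfolding r_def by (intro divide_pos_pos) auto
  have ann: "annihilates (\<lambda>n. w n * r n ^ m)" for m
  proof (induction m)
    case (Suc m)
    then show ?case
      using annihilates_resolvent(3)[OF Suc M(2) L s] by (simp add: r_def mult_ac)
  qed (use assms in simp)
  have "freq n * w n * r n = 0" for n
  proof (rule power_sums_eq_0[of "\<lambda>n. freq n * w n * r n" r])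
    show "summable (\<lambda>n. \<bar>freq n * w n * r n\<bar>)"
      using annihilates_resolvent(2)[OF assms M(2) L s] by (simp add: r_def)
    show "r n > 0" for n by (rule r_pos)
    show "r \<longlonglongrightarrow> 0"
    proof (rule Lim_null_comparison)
      show "\<forall>\<^sub>F n in sequentially. norm (r n) \<le> 1 / freq n"
      proof (intro always_eventually allI)
        fix n
        show "norm (r n) \<le> 1 / freq n"
          using r_pos[of n] denom[of n] freq_pos[of n] by (auto simp: r_def intro!: divide_left_mono)
      qed
      show "(\<lambda>n. 1 / freq n) \<longlonglongrightarrow> 0"
        by (rule tendsto_divide_0[OF tendsto_const filterlim_at_top_imp_at_infinity[OF freq_at_top]])
    qed
    show "inj r"
    proof (rule injI)
      fix i j assume "r i = r j"
      then show "i = j" using eigval_inj[of i j] r_pos[of i] r_pos[of j] by (auto simp: r_def)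
    qed
    show "(\<lambda>n. freq n * w n * r n * r n ^ m) sums 0" for m
      using annihilates_resolvent(1)[OF ann[of m] M(2) L s] by (simp add: r_def mult_ac)
  qed
  from this[of n] show ?thesis
    using freq_pos[of n] r_pos[of n] by auto
qed

end

section \<open>Fubini for Lebesgue measurable functions\<close>

lemma AE_lebesgue_fst:
  assumes "AE x in (lebesgue :: real measure). P x"
  shows "AE p in (lebesgue :: (real \<times> real) measure). P (fst p)"
proof -
  obtain N where N: "N \<in> null_sets lborel" "{x. \<not> P x} \<subseteq> N"
    using assms unfolding AE_completion_iff by (auto simp: eventually_ae_filter)
  have "N \<times> (UNIV :: real set) \<in> null_sets (lborel \<Otimes>\<^sub>M lborel)"
    using N(1) by (intro lborel.times_in_null_sets1) auto
  then have "N \<times> (UNIV :: real set) \<in> null_sets lborel"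
    by (simp add: lborel_prod)
  then show ?thesis
    unfolding AE_completion_iff by (rule AE_I') (use N(2) in auto)
qed

lemma AE_lebesgue_swap:
  assumes "AE p in (lebesgue :: (real \<times> real) measure). P p"
  shows "AE p in (lebesgue :: (real \<times> real) measure). P (prod.swap p)"
proof -
  obtain N where N: "N \<in> null_sets lborel" "{x. \<not> P x} \<subseteq> N"
    using assms unfolding AE_completion_iff by (auto simp: eventually_ae_filter)
  have "prod.swap -` N \<inter> space (lborel \<Otimes>\<^sub>M lborel) \<in> null_sets (lborel \<Otimes>\<^sub>M lborel :: (real \<times> real) measure)"
  proof (rule null_setsI)
    have swap: "(prod.swap :: real \<times> real \<Rightarrow> _) \<in> lborel \<Otimes>\<^sub>M lborel \<rightarrow>\<^sub>M lborel \<Otimes>\<^sub>M lborel"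
      by (simp add: prod.swap_def[abs_def] cong del: measurable_cong_simp)
    have N': "N \<in> sets (lborel \<Otimes>\<^sub>M lborel)" "emeasure (lborel \<Otimes>\<^sub>M lborel) N = 0"
      using N(1) unfolding lborel_prod by (auto simp del: sets_lborel)
    then show "prod.swap -` N \<inter> space (lborel \<Otimes>\<^sub>M lborel) \<in> sets (lborel \<Otimes>\<^sub>M lborel)"
      by (intro measurable_sets[OF swap])
    have "emeasure (lborel \<Otimes>\<^sub>M lborel) (prod.swap -` N \<inter> space (lborel \<Otimes>\<^sub>M lborel)) =
        emeasure (distr (lborel \<Otimes>\<^sub>M lborel) (lborel \<Otimes>\<^sub>M lborel) prod.swap) N"
      by (rule emeasure_distr[symmetric, OF swap N'(1)])
    also have "distr (lborel \<Otimes>\<^sub>M lborel) (lborel \<Otimes>\<^sub>M lborel) prod.swap = (lborel \<Otimes>\<^sub>M lborel :: (real \<times> real) measure)"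
    proof -
      have "lborel \<Otimes>\<^sub>M lborel = distr (lborel \<Otimes>\<^sub>M lborel) (lborel \<Otimes>\<^sub>M lborel) (\<lambda>(x::real, y::real). (y, x))"
        by (rule lborel_pair.distr_pair_swap)
      then show ?thesis by (simp add: prod.swap_def[abs_def] case_prod_beta')
    qed
    finally show "emeasure (lborel \<Otimes>\<^sub>M lborel) (prod.swap -` N \<inter> space (lborel \<Otimes>\<^sub>M lborel)) = 0"
      using N' by simp
  qed
  then have "prod.swap -` N \<in> null_sets (lborel :: (real \<times> real) measure)"
    by (simp add: lborel_prod)
  then show ?thesis
    unfolding AE_completion_iff by (rule AE_I') (use N(2) in auto)
qed

text \<open>Lebesgue measure on the plane is the completion of a product measure and not itself such
  a product. The product theorems are therefore applied to Borel representatives and carried back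
  almost everywhere.\<close>

lemma lebesgue_borel_representative:
  fixes f :: "'a::euclidean_space \<Rightarrow> real"
  assumes "f \<in> borel_measurable lebesgue"
  obtains g where "g \<in> borel_measurable borel" "AE x in lebesgue. f x = g x"
  using completion_ex_borel_measurable_real[OF assms] by (auto simp: AE_completion_iff)

lemma lebesgue_integrable_representative:
  fixes f g :: "'a::euclidean_space \<Rightarrow> real"
  assumes g: "g \<in> borel_measurable borel" and eq: "AE x in lebesgue. f x = g x"
  shows "f \<in> borel_measurable lebesgue"
    and "integrable lebesgue f \<longleftrightarrow> integrable lborel g"
    and "integral\<^sup>L lebesgue f = integral\<^sup>L lborel g"
proof -
  have g': "g \<in> borel_measurable lborel" "g \<in> borel_measurable lebesgue"
    using g by (auto intro: measurable_completion)
  have eq': "AE x in lebesgue. g x = f x" using eq by auto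
  show f: "f \<in> borel_measurable lebesgue"
    by (rule borel_measurable_AE[OF g'(2) eq'])
  show "integrable lebesgue f \<longleftrightarrow> integrable lborel g"
    using integrable_cong_AE[OF f g'(2) eq] integrable_completion[OF g'(1)] by simp
  show "integral\<^sup>L lebesgue f = integral\<^sup>L lborel g"
    using integral_cong_AE[OF f g'(2) eq] integral_completion[OF g'(1)] by simp
qed

lemma measurable_fst_lebesgue:
  fixes f :: "real \<Rightarrow> real"
  assumes "f \<in> borel_measurable lebesgue"
  shows "(\<lambda>p::real \<times> real. f (fst p)) \<in> borel_measurable lebesgue"
proof -
  obtain g where g: "g \<in> borel_measurable borel" "AE x in lebesgue. f x = g x"
    using lebesgue_borel_representative[OF assms] .
  have "(\<lambda>p::real \<times> real. g (fst p)) \<in> borel_measurable borel"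
    using g(1) by (intro measurable_compose[OF _ g(1)] borel_measurable_continuous_onI continuous_intros)
  then show ?thesis
    using AE_lebesgue_fst[OF g(2)] by (rule lebesgue_integrable_representative(1))
qed

lemma lebesgue_swap:
  fixes f :: "real \<times> real \<Rightarrow> real"
  assumes f: "f \<in> borel_measurable lebesgue"
  shows "(\<lambda>p. f (prod.swap p)) \<in> borel_measurable lebesgue"
    and "integrable lebesgue (\<lambda>p. f (prod.swap p)) \<longleftrightarrow> integrable lebesgue f"
    and "integral\<^sup>L lebesgue (\<lambda>p. f (prod.swap p)) = integral\<^sup>L lebesgue f"
proof -
  obtain g where g: "g \<in> borel_measurable borel" "AE x in lebesgue. f x = g x"
    using lebesgue_borel_representative[OF f] .
  have swap: "(\<lambda>p. g (prod.swap p)) \<in> borel_measurable borel"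
    using g(1) unfolding prod.swap_def
    by (intro measurable_compose[OF _ g(1)] borel_measurable_continuous_onI continuous_intros)
  note rep = lebesgue_integrable_representative[OF swap AE_lebesgue_swap[OF g(2)]]
  show "(\<lambda>p. f (prod.swap p)) \<in> borel_measurable lebesgue" by (rule rep)
  have g': "g \<in> borel_measurable (lborel \<Otimes>\<^sub>M lborel)" using g(1) by (simp add: lborel_prod)
  show "integrable lebesgue (\<lambda>p. f (prod.swap p)) \<longleftrightarrow> integrable lebesgue f"
    using lborel_pair.integrable_product_swap_iff[of g]
    by (simp add: rep(2)[unfolded prod.swap_def] lebesgue_integrable_representative[OF g] lborel_prod prod.swap_def case_prod_beta')
  show "integral\<^sup>L lebesgue (\<lambda>p. f (prod.swap p)) = integral\<^sup>L lebesgue f"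
    using lborel_pair.integral_product_swap[OF g']
    by (simp add: rep(3)[unfolded prod.swap_def] lebesgue_integrable_representative[OF g] lborel_prod prod.swap_def case_prod_beta')
qed

lemma AE_measurable_slice:
  fixes f :: "real \<times> real \<Rightarrow> real"
  assumes "f \<in> borel_measurable lebesgue"
  shows "AE x in lebesgue. (\<lambda>y. f (x, y)) \<in> borel_measurable lebesgue"
proof -
  obtain g where g: "g \<in> borel_measurable borel" "AE x in lebesgue. f x = g x"
    using lebesgue_borel_representative[OF assms] .
  have "AE x in lborel. AE y in lborel. f (x, y) = g (x, y)"
    using g(2) unfolding AE_completion_iff lborel_prod[symmetric] by (rule lborel_pair.AE_pair)
  then show ?thesis
    unfolding AE_completion_iff
  proof eventually_elim
    case (elim x)
    have "(\<lambda>y. g (x, y)) \<in> borel_measurable borel"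
      by (intro measurable_compose[OF _ g(1)] borel_measurable_continuous_onI continuous_intros)
    then show ?case
      using elim by (intro lebesgue_integrable_representative(1)) (auto simp: AE_completion_iff)
  qed
qed

lemma Fubini_lebesgue:
  fixes f :: "real \<times> real \<Rightarrow> real"
  assumes f: "integrable lebesgue f"
  shows "AE x in lebesgue. integrable lebesgue (\<lambda>y. f (x, y))"
    and "integrable lebesgue (\<lambda>x. \<integral>y. f (x, y) \<partial>lebesgue)"
    and "(\<integral>x. \<integral>y. f (x, y) \<partial>lebesgue \<partial>lebesgue) = integral\<^sup>L lebesgue f"
proof -
  obtain g where g: "g \<in> borel_measurable borel" "AE x in lebesgue. f x = g x"
    using lebesgue_borel_representative[of f] f by auto
  have g_int: "integrable (lborel \<Otimes>\<^sub>M lborel) g"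
    using f lebesgue_integrable_representative(2)[OF g] by (simp add: lborel_prod)
  have slice: "(\<lambda>y. g (x, y)) \<in> borel_measurable borel" for x
    by (intro measurable_compose[OF _ g(1)] borel_measurable_continuous_onI continuous_intros)
  have "AE x in lborel. AE y in lborel. f (x, y) = g (x, y)"
    using g(2) unfolding AE_completion_iff lborel_prod[symmetric] by (rule lborel_pair.AE_pair)
  then have ae: "AE x in lborel. AE y in lebesgue. f (x, y) = g (x, y)"
    by (simp add: AE_completion_iff)
  have "AE x in lborel. integrable lborel (\<lambda>y. g (x, y))"
    using lborel_pair.AE_integrable_fst'[OF g_int] .
  with ae show "AE x in lebesgue. integrable lebesgue (\<lambda>y. f (x, y))"
    unfolding AE_completion_iff
    by eventually_elim (simp add: lebesgue_integrable_representative(2)[OF slice] AE_completion_iff)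
  have inner: "AE x in lebesgue. (\<integral>y. f (x, y) \<partial>lebesgue) = (\<integral>y. g (x, y) \<partial>lborel)"
    using ae unfolding AE_completion_iff
    by eventually_elim (simp add: lebesgue_integrable_representative(3)[OF slice] AE_completion_iff)
  have int: "integrable lborel (\<lambda>x. \<integral>y. g (x, y) \<partial>lborel)"
    using lborel_pair.integrable_fst'[OF g_int] .
  then have "(\<lambda>x. \<integral>y. g (x, y) \<partial>lborel) \<in> borel_measurable borel"
    by (simp add: integrable_iff_bounded)
  note rep = lebesgue_integrable_representative[OF this inner]
  show "integrable lebesgue (\<lambda>x. \<integral>y. f (x, y) \<partial>lebesgue)" using rep(2) int by simp
  show "(\<integral>x. \<integral>y. f (x, y) \<partial>lebesgue \<partial>lebesgue) = integral\<^sup>L lebesgue f"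
    using rep(3) lborel_pair.integral_fst'[OF g_int] lebesgue_integrable_representative(3)[OF g]
    by (simp add: lborel_prod)
qed

lemma integrable_lebesgue_tensor:
  fixes f g :: "real \<Rightarrow> real"
  assumes f: "integrable lebesgue f" and g: "integrable lebesgue g"
  shows "integrable lebesgue (\<lambda>p. f (fst p) * g (snd p))"
proof -
  obtain f' where f': "f' \<in> borel_measurable borel" "AE x in lebesgue. f x = f' x"
    using lebesgue_borel_representative[of f] f by auto
  obtain g' where g': "g' \<in> borel_measurable borel" "AE x in lebesgue. g x = g' x"
    using lebesgue_borel_representative[of g] g by auto
  have int: "integrable lborel f'" "integrable lborel g'"
    using f g lebesgue_integrable_representative(2)[OF f'] lebesgue_integrable_representative(2)[OF g'] by auto
  have ae: "AE p in lebesgue. f (fst p) * g (snd p) = f' (fst p) * g' (snd p)"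
    using AE_lebesgue_fst[OF f'(2)] AE_lebesgue_swap[OF AE_lebesgue_fst[OF g'(2)]]
    by eventually_elim simp
  have meas: "(\<lambda>p. f' (fst p) * g' (snd p)) \<in> borel_measurable borel"
    by (intro borel_measurable_times measurable_compose[OF _ f'(1)] measurable_compose[OF _ g'(1)]
        borel_measurable_continuous_onI continuous_intros)
  have "integrable (lborel \<Otimes>\<^sub>M lborel) (\<lambda>p. f' (fst p) * g' (snd p))"
    using meas int by (intro lborel_pair.Fubini_integrable) (auto simp: lborel_prod abs_mult)
  then show ?thesis
    using lebesgue_integrable_representative(2)[OF meas ae] by (simp add: lborel_prod)
qed

section \<open>Transfer to the unit interval and the unit square\<close>

lemma open_square_lebesgue: "open_square \<in> sets lebesgue"
  by (simp add: borel_open open_Times sets_completionI_sets)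

lemma integrable_unit_square:
  fixes f :: "real \<times> real \<Rightarrow> real"
  shows "integrable unit_square f \<longleftrightarrow> integrable lebesgue (\<lambda>p. indicator open_square p * f p)"
    and "integral\<^sup>L unit_square f = integral\<^sup>L lebesgue (\<lambda>p. indicator open_square p * f p)"
    and "f \<in> borel_measurable unit_square \<longleftrightarrow>
      (\<lambda>p. indicator open_square p * f p) \<in> borel_measurable lebesgue"
  using open_square_lebesgue
  by (auto simp: integrable_restrict_space integral_restrict_space borel_measurable_restrict_space_iff)

lemma integrable_unit_interval:
  fixes f :: "real \<Rightarrow> real"
  shows "integrable unit_interval f \<longleftrightarrow> integrable lebesgue (\<lambda>x. indicator {0<..<1} x * f x)"
    and "integral\<^sup>L unit_interval f = integral\<^sup>L lebesgue (\<lambda>x. indicator {0<..<1} x * f x)"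
    and "f \<in> borel_measurable unit_interval \<longleftrightarrow>
      (\<lambda>x. indicator {0<..<1} x * f x) \<in> borel_measurable lebesgue"
  by (auto simp: integrable_restrict_space integral_restrict_space borel_measurable_restrict_space_iff)

lemma AE_unit_interval:
  "(AE x in unit_interval. P x) \<longleftrightarrow> (AE x in lebesgue. x \<in> {0<..<1} \<longrightarrow> P x)"
  by (simp add: AE_restrict_space_iff)

lemma indicator_open_square:
  "indicator open_square p = (indicator {0<..<1} (fst p) * indicator {0<..<1} (snd p) :: real)"
  by (cases p) (simp add: indicator_times)

lemma Fubini_unit_square:
  fixes f :: "real \<times> real \<Rightarrow> real"
  assumes f: "integrable unit_square f"
  shows "AE x in unit_interval. integrable unit_interval (\<lambda>y. f (x, y))"
    and "integrable unit_interval (\<lambda>x. \<integral>y. f (x, y) \<partial>unit_interval)"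
    and "(\<integral>x. \<integral>y. f (x, y) \<partial>unit_interval \<partial>unit_interval) = integral\<^sup>L unit_square f"
proof -
  note F = Fubini_lebesgue[OF f[unfolded integrable_unit_square(1)]]
  show "AE x in unit_interval. integrable unit_interval (\<lambda>y. f (x, y))"
    using F(1) unfolding AE_unit_interval integrable_unit_interval(1)
    by eventually_elim (auto simp: indicator_open_square)
  show "integrable unit_interval (\<lambda>x. \<integral>y. f (x, y) \<partial>unit_interval)"
    using F(2) unfolding integrable_unit_interval by (simp add: indicator_open_square mult.assoc)
  show "(\<integral>x. \<integral>y. f (x, y) \<partial>unit_interval \<partial>unit_interval) = integral\<^sup>L unit_square f"
    using F(3) unfolding integrable_unit_interval integrable_unit_square
    by (simp add: indicator_open_square mult.assoc)
qed

lemma AE_measurable_slice_unit_square: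
  fixes f :: "real \<times> real \<Rightarrow> real"
  assumes "f \<in> borel_measurable unit_square"
  shows "AE x in unit_interval. (\<lambda>y. f (x, y)) \<in> borel_measurable unit_interval"
  using AE_measurable_slice[OF assms[unfolded integrable_unit_square(3)]]
  unfolding AE_unit_interval integrable_unit_interval(3)
  by eventually_elim (auto simp: indicator_open_square)

lemma unit_square_swap:
  fixes f :: "real \<times> real \<Rightarrow> real"
  assumes f: "f \<in> borel_measurable unit_square"
  shows "(\<lambda>p. f (prod.swap p)) \<in> borel_measurable unit_square"
    and "integrable unit_square (\<lambda>p. f (prod.swap p)) \<longleftrightarrow> integrable unit_square f"
    and "integral\<^sup>L unit_square (\<lambda>p. f (prod.swap p)) = integral\<^sup>L unit_square f"
proof -
  have "indicator open_square (prod.swap p) = (indicator open_square p :: real)" for p :: "real \<times> real"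
    by (simp add: indicator_open_square)
  then show "(\<lambda>p. f (prod.swap p)) \<in> borel_measurable unit_square"
    and "integrable unit_square (\<lambda>p. f (prod.swap p)) \<longleftrightarrow> integrable unit_square f"
    and "integral\<^sup>L unit_square (\<lambda>p. f (prod.swap p)) = integral\<^sup>L unit_square f"
    using lebesgue_swap[OF f[unfolded integrable_unit_square(3)]]
    unfolding integrable_unit_square by simp_all
qed

lemma square_integrable_swap:
  "square_integrable unit_square k \<Longrightarrow> square_integrable unit_square (\<lambda>p. k (prod.swap p))"
  using unit_square_swap(1)[of k] unit_square_swap(2)[of "\<lambda>p. (k p)\<^sup>2"]
  by (auto simp: square_integrable_def)

lemma square_integrable_tensor:
  assumes f: "square_integrable unit_interval f" and g: "square_integrable unit_interval g"
  shows "square_integrable unit_square (\<lambda>p. f (fst p) * g (snd p))"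
proof -
  let ?f = "\<lambda>x. indicator {0<..<1} x * f x" and ?g = "\<lambda>x. indicator {0<..<1} x * g x"
  have meas: "?f \<in> borel_measurable lebesgue" "?g \<in> borel_measurable lebesgue"
    using f g by (simp_all add: square_integrable_def integrable_unit_interval(3))
  have "(\<lambda>p. ?f (fst p) * ?g (snd p)) \<in> borel_measurable lebesgue"
    using measurable_fst_lebesgue[OF meas(1)] lebesgue_swap(1)[OF measurable_fst_lebesgue[OF meas(2)]]
    by simp
  then have "(\<lambda>p. f (fst p) * g (snd p)) \<in> borel_measurable unit_square"
    unfolding integrable_unit_square(3) indicator_open_square by (simp add: mult_ac)
  moreover have "integrable lebesgue (\<lambda>p. (indicator {0<..<1} (fst p) * (f (fst p))\<^sup>2) * (indicator {0<..<1} (snd p) * (g (snd p))\<^sup>2))"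
    using f g by (intro integrable_lebesgue_tensor) (simp_all add: square_integrable_def integrable_unit_interval(1))
  ultimately show ?thesis
    unfolding square_integrable_def integrable_unit_square(1) indicator_open_square
    by (simp add: power_mult_distrib mult_ac)
qed

section \<open>Integral operators on \<open>L\<^sup>2(0,1)\<close>\<close>

lemma L2_rel_refl_iff: "L2_rel f f \<longleftrightarrow> square_integrable unit_interval f"
  by (simp add: L2_rel_def)

lemma square_integrable_rep_L2: "square_integrable unit_interval (rep_L2 u)"
  using Quotient_rep_reflp[OF Quotient_L2, of u] by (simp add: L2_rel_refl_iff)

lemma abs_rep_L2: "abs_L2 (rep_L2 u) = u"
  by (rule Quotient_abs_rep[OF Quotient_L2])

lemma rep_abs_L2:
  "square_integrable unit_interval f \<Longrightarrow> AE x in unit_interval. rep_L2 (abs_L2 f) x = f x"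
  using Quotient_rep_abs[OF Quotient_L2, of f] by (simp add: L2_rel_def)

lemma abs_L2_eqI:
  "square_integrable unit_interval f \<Longrightarrow> square_integrable unit_interval g \<Longrightarrow>
    AE x in unit_interval. f x = g x \<Longrightarrow> abs_L2 f = abs_L2 g"
  using Quotient_rel_abs[OF Quotient_L2, of f g] by (simp add: L2_rel_def)

lemma L2_eqI: "AE x in unit_interval. rep_L2 u x = rep_L2 v x \<Longrightarrow> u = v"
  using abs_L2_eqI[OF square_integrable_rep_L2 square_integrable_rep_L2] by (simp add: abs_rep_L2)

lemma inner_abs_L2:
  "square_integrable unit_interval f \<Longrightarrow> square_integrable unit_interval g \<Longrightarrow>
    inner (abs_L2 f) (abs_L2 g) = (\<integral>x. f x * g x \<partial>unit_interval)"
  by (simp add: inner_L2.abs_eq L2_rel_refl_iff)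

lemma inner_rep_L2: "inner u v = (\<integral>x. rep_L2 u x * rep_L2 v x \<partial>unit_interval)"
  using inner_abs_L2[OF square_integrable_rep_L2 square_integrable_rep_L2] by (simp add: abs_rep_L2)

lemma norm_abs_L2:
  "square_integrable unit_interval f \<Longrightarrow> (norm (abs_L2 f))\<^sup>2 = (\<integral>x. (f x)\<^sup>2 \<partial>unit_interval)"
  unfolding power2_norm_eq_inner by (simp add: inner_abs_L2 power2_eq_square)

lemma plus_abs_L2:
  "square_integrable unit_interval f \<Longrightarrow> square_integrable unit_interval g \<Longrightarrow>
    abs_L2 f + abs_L2 g = abs_L2 (\<lambda>x. f x + g x)"
  by (simp add: plus_L2.abs_eq L2_rel_refl_iff)

lemma scaleR_abs_L2:
  "square_integrable unit_interval f \<Longrightarrow> r *\<^sub>R abs_L2 f = abs_L2 (\<lambda>x. r * f x)"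
  by (simp add: scaleR_L2.abs_eq L2_rel_refl_iff)

lemma rep_plus_L2: "AE x in unit_interval. rep_L2 (u + v) x = rep_L2 u x + rep_L2 v x"
  using rep_abs_L2[OF square_integrable_add[OF square_integrable_rep_L2[of u] square_integrable_rep_L2[of v]]]
  by (simp add: abs_rep_L2 flip: plus_abs_L2[OF square_integrable_rep_L2 square_integrable_rep_L2])

lemma rep_scaleR_L2: "AE x in unit_interval. rep_L2 (r *\<^sub>R u) x = r * rep_L2 u x"
  using rep_abs_L2[OF square_integrable_scale[OF square_integrable_rep_L2[of u], of r]]
  by (simp add: abs_rep_L2 flip: scaleR_abs_L2[OF square_integrable_rep_L2])

section \<open>The operator of a square integrable kernel and its adjoint\<close>

locale L2_kernel =
  fixes k :: "real \<times> real \<Rightarrow> real"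
  assumes square_integrable: "square_integrable unit_square k"
begin

definition slice :: "real \<Rightarrow> L2" where
  "slice x = abs_L2 (\<lambda>y. k (x, y))"

definition slice_norm2 :: "real \<Rightarrow> real" where
  "slice_norm2 x = (\<integral>y. (k (x, y))\<^sup>2 \<partial>unit_interval)"

lemma AE_square_integrable_slice:
  "AE x in unit_interval. square_integrable unit_interval (\<lambda>y. k (x, y))"
  using AE_measurable_slice_unit_square[of k] Fubini_unit_square(1)[of "\<lambda>p. (k p)\<^sup>2"] square_integrable
  unfolding square_integrable_def by auto

lemma integrable_slice_norm2:
  "integrable unit_interval slice_norm2"
  "integral\<^sup>L unit_interval slice_norm2 = (\<integral>p. (k p)\<^sup>2 \<partial>unit_square)"
  unfolding slice_norm2_def[abs_def] using Fubini_unit_square(2,3)[of "\<lambda>p. (k p)\<^sup>2"] square_integrable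
  by (auto simp: square_integrable_def)

lemma AE_norm_slice: "AE x in unit_interval. (norm (slice x))\<^sup>2 = slice_norm2 x"
  using AE_square_integrable_slice
  by eventually_elim (simp add: slice_def slice_norm2_def norm_abs_L2)

lemma AE_inner_slice:
  assumes "square_integrable unit_interval g"
  shows "AE x in unit_interval. (\<integral>y. k (x, y) * g y \<partial>unit_interval) = inner (slice x) (abs_L2 g)"
  using AE_square_integrable_slice
  by eventually_elim (simp add: slice_def inner_abs_L2 assms)

lemma square_integrable_integral:
  assumes g: "square_integrable unit_interval g"
  shows "square_integrable unit_interval (\<lambda>x. \<integral>y. k (x, y) * g y \<partial>unit_interval)"
proof -
  have one: "square_integrable unit_interval (\<lambda>x. 1)"
    by (auto simp: square_integrable_def integrable_unit_interval intro!: borel_measurable_indicator)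
  \<comment> \<open>Extending \<open>g\<close> to the square by the constant 1 in x makes the
    product integrable, so that Fubini supplies measurability in x.\<close>
  have "integrable unit_square (\<lambda>p. k p * (1 * g (snd p)))"
    using square_integrable square_integrable_tensor[OF one g] by (rule square_integrable_mult)
  from Fubini_unit_square(2)[OF this]
  have meas: "(\<lambda>x. \<integral>y. k (x, y) * g y \<partial>unit_interval) \<in> borel_measurable unit_interval"
    by simp
  have "integrable unit_interval (\<lambda>x. (\<integral>y. k (x, y) * g y \<partial>unit_interval)\<^sup>2)"
  proof (rule Bochner_Integration.integrable_bound)
    show "integrable unit_interval (\<lambda>x. slice_norm2 x * (norm (abs_L2 g))\<^sup>2)"
      using integrable_slice_norm2 by simp
    show "(\<lambda>x. (\<integral>y. k (x, y) * g y \<partial>unit_interval)\<^sup>2) \<in> borel_measurable unit_interval"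
      using meas by simp
    show "AE x in unit_interval. norm ((\<integral>y. k (x, y) * g y \<partial>unit_interval)\<^sup>2)
        \<le> norm (slice_norm2 x * (norm (abs_L2 g))\<^sup>2)"
      using AE_inner_slice[OF g] AE_norm_slice
    proof eventually_elim
      case (elim x)
      show ?case
        unfolding elim(1) elim(2)[symmetric]
        using Cauchy_Schwarz_ineq[of "slice x" "abs_L2 g"] by (simp add: power2_norm_eq_inner)
    qed
  qed
  with meas show ?thesis by (simp add: square_integrable_def)
qed

text \<open>Values of the operator become inner products with the slices k(x, .), so linearity and
  Bessel-type inequalities can be used pointwise before integrating in x.\<close>

lemma AE_integral_operator:
  "AE x in unit_interval. rep_L2 (integral_operator k v) x = inner (slice x) v"
  using rep_abs_L2[OF square_integrable_integral[OF square_integrable_rep_L2[of v]]]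
    AE_inner_slice[OF square_integrable_rep_L2[of v]]
  unfolding integral_operator_def by eventually_elim (simp add: abs_rep_L2)

lemma integral_operator_abs_L2:
  assumes g: "square_integrable unit_interval g"
  shows "integral_operator k (abs_L2 g) = abs_L2 (\<lambda>x. \<integral>y. k (x, y) * g y \<partial>unit_interval)"
proof (rule L2_eqI)
  show "AE x in unit_interval. rep_L2 (integral_operator k (abs_L2 g)) x
      = rep_L2 (abs_L2 (\<lambda>x. \<integral>y. k (x, y) * g y \<partial>unit_interval)) x"
    using AE_integral_operator[of "abs_L2 g"] AE_inner_slice[OF g]
      rep_abs_L2[OF square_integrable_integral[OF g]]
    by eventually_elim simp
qed

lemma inner_integral_operator:
  assumes f: "square_integrable unit_interval f" and g: "square_integrable unit_interval g"
  shows "inner (integral_operator k (abs_L2 g)) (abs_L2 f) = (\<integral>p. k p * (f (fst p) * g (snd p)) \<partial>unit_square)"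
proof -
  have "integrable unit_square (\<lambda>p. k p * (f (fst p) * g (snd p)))"
    using square_integrable square_integrable_tensor[OF f g] by (rule square_integrable_mult)
  from Fubini_unit_square(3)[OF this] show ?thesis
    unfolding integral_operator_abs_L2[OF g] inner_abs_L2[OF square_integrable_integral[OF g] f]
    by (simp add: mult.left_commute mult.commute[of _ "f _"])
qed

text \<open>The hypothesis is applied to the slice of k at each x and then integrated. For an
  orthonormal system with B = 1 this is the Hilbert-Schmidt bound; for a single vector v with B =
  norm v ^ 2 it bounds the operator.\<close>

lemma sum_norm_integral_operator_le:
  assumes A: "finite A" and v: "\<And>x. (\<Sum>n\<in>A. (inner x (v n))\<^sup>2) \<le> B * (norm x)\<^sup>2"
  shows "(\<Sum>n\<in>A. (norm (integral_operator k (v n)))\<^sup>2) \<le> B * (\<integral>p. (k p)\<^sup>2 \<partial>unit_square)"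
proof -
  have sq: "integrable unit_interval (\<lambda>x. (rep_L2 u x)\<^sup>2)" for u
    using square_integrable_rep_L2[of u] by (simp add: square_integrable_def)
  have "(\<Sum>n\<in>A. (norm (integral_operator k (v n)))\<^sup>2)
      = (\<Sum>n\<in>A. \<integral>x. (rep_L2 (integral_operator k (v n)) x)\<^sup>2 \<partial>unit_interval)"
    unfolding power2_norm_eq_inner inner_rep_L2 by (simp add: power2_eq_square)
  also have "\<dots> = (\<integral>x. (\<Sum>n\<in>A. (rep_L2 (integral_operator k (v n)) x)\<^sup>2) \<partial>unit_interval)"
    by (intro Bochner_Integration.integral_sum[symmetric] sq)
  also have "\<dots> \<le> (\<integral>x. B * slice_norm2 x \<partial>unit_interval)"
  proof (rule integral_mono_AE)
    have "AE x in unit_interval. \<forall>n\<in>A. rep_L2 (integral_operator k (v n)) x = inner (slice x) (v n)"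
      using A AE_integral_operator by (intro AE_finite_allI)
    then show "AE x in unit_interval. (\<Sum>n\<in>A. (rep_L2 (integral_operator k (v n)) x)\<^sup>2) \<le> B * slice_norm2 x"
      using AE_norm_slice
    proof eventually_elim
      case (elim x)
      then show ?case using v[of "slice x"] by simp
    qed
  qed (use sq integrable_slice_norm2 in auto)
  finally show ?thesis by (simp add: integrable_slice_norm2)
qed

lemma bounded_linear_integral_operator: "bounded_linear (integral_operator k)"
proof (rule bounded_linear_intro)
  show "integral_operator k (u + v) = integral_operator k u + integral_operator k v" for u v
  proof (rule L2_eqI)
    show "AE x in unit_interval. rep_L2 (integral_operator k (u + v)) x
        = rep_L2 (integral_operator k u + integral_operator k v) x"
      using AE_integral_operator[of "u + v"] AE_integral_operator[of u] AE_integral_operator[of v]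
        rep_plus_L2[of "integral_operator k u" "integral_operator k v"]
      by eventually_elim (simp add: inner_right_distrib)
  qed
  show "integral_operator k (r *\<^sub>R u) = r *\<^sub>R integral_operator k u" for r u
  proof (rule L2_eqI)
    show "AE x in unit_interval. rep_L2 (integral_operator k (r *\<^sub>R u)) x
        = rep_L2 (r *\<^sub>R integral_operator k u) x"
      using AE_integral_operator[of "r *\<^sub>R u"] AE_integral_operator[of u]
        rep_scaleR_L2[of r "integral_operator k u"]
      by eventually_elim simp
  qed
  fix v
  let ?c = "\<integral>p. (k p)\<^sup>2 \<partial>unit_square"
  have "(norm (integral_operator k v))\<^sup>2 \<le> (norm v)\<^sup>2 * ?c"
    using sum_norm_integral_operator_le[of "{()}" "\<lambda>_. v" "(norm v)\<^sup>2"]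
      Cauchy_Schwarz_ineq[of _ v] by (simp add: power2_norm_eq_inner mult.commute)
  also have "\<dots> = (norm v * sqrt ?c)\<^sup>2"
    by (simp add: power_mult_distrib)
  finally show "norm (integral_operator k v) \<le> norm v * sqrt ?c"
    by (rule power2_le_imp_le) simp
qed

lemma integral_operator_adjoint:
  "inner (integral_operator k v) w = inner v (integral_operator (\<lambda>p. k (prod.swap p)) w)"
proof -
  interpret swap: L2_kernel "\<lambda>p. k (prod.swap p)"
    by unfold_locales (rule square_integrable_swap[OF square_integrable])
  let ?F = "\<lambda>p. k p * (rep_L2 w (fst p) * rep_L2 v (snd p))"
  have "integrable unit_square ?F"
    using square_integrable square_integrable_tensor[OF square_integrable_rep_L2 square_integrable_rep_L2]
    by (rule square_integrable_mult)
  then have "(\<integral>p. ?F (prod.swap p) \<partial>unit_square) = (\<integral>p. ?F p \<partial>unit_square)"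
    by (intro unit_square_swap(3)) auto
  then show ?thesis
    using inner_integral_operator[OF square_integrable_rep_L2[of w] square_integrable_rep_L2[of v]]
      swap.inner_integral_operator[OF square_integrable_rep_L2[of v] square_integrable_rep_L2[of w]]
    by (simp add: abs_rep_L2 inner_commute mult.commute)
qed

end

section \<open>Completeness of \<open>L\<^sup>2(0,1)\<close> and of the sine system\<close>

lemma square_integrable_continuous:
  fixes g :: "real \<Rightarrow> real"
  assumes g: "continuous_on {0..1} g"
  shows "square_integrable unit_interval g"
proof -
  have "integrable unit_interval h" if "continuous_on {0..1} h" for h :: "real \<Rightarrow> real"
    using set_integrable_subset[OF absolutely_integrable_continuous_real[OF that], of "{0<..<1}"]
    by (auto simp: set_integrable_def integrable_unit_interval(1) greaterThanLessThan_subseteq_atLeastAtMost_iff)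
  from this[OF g] this[of "\<lambda>x. (g x)\<^sup>2"] g show ?thesis
    by (auto simp: square_integrable_def intro: continuous_intros)
qed

lemma integral_unit_interval_FTC:
  fixes F g :: "real \<Rightarrow> real"
  assumes F: "\<And>x. (F has_real_derivative g x) (at x)" and g: "\<And>x. isCont g x"
  shows "(\<integral>x. g x \<partial>unit_interval) = F 1 - F 0"
proof -
  have meas: "(\<lambda>x. g x * indicator {0..1} x) \<in> borel_measurable borel"
    using g by (intro borel_measurable_times borel_measurable_indicator borel_measurable_continuous_onI)
      (auto simp: continuous_on_eq_continuous_at)
  have "AE x in lborel. x \<noteq> 0 \<and> x \<noteq> (1::real)"
    using AE_lborel_singleton[of "0::real"] AE_lborel_singleton[of "1::real"] by eventually_elim simp
  then have "AE x in lebesgue. indicator {0<..<1} x * g x = g x * indicator {0..1} x"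
    unfolding AE_completion_iff by eventually_elim (auto simp: indicator_def)
  from lebesgue_integrable_representative(3)[OF meas this] show ?thesis
    using integral_FTC_Icc_real[of 0 1 F g] assms by (simp add: integrable_unit_interval(2))
qed

lemma square_integrable_one: "square_integrable unit_interval (\<lambda>x. 1)"
  by (intro square_integrable_continuous continuous_intros)

lemma square_integrable_diff:
  "square_integrable M f \<Longrightarrow> square_integrable M g \<Longrightarrow> square_integrable M (\<lambda>x. f x - g x)"
  using square_integrable_add[of M f "\<lambda>x. -1 * g x"] square_integrable_scale[of M g "-1"] by simp

lemma diff_abs_L2:
  assumes "square_integrable unit_interval f" "square_integrable unit_interval g"
  shows "abs_L2 f - abs_L2 g = abs_L2 (\<lambda>x. f x - g x)"
  using plus_abs_L2[OF assms(1) square_integrable_scale[OF assms(2), of "-1"]] scaleR_abs_L2[OF assms(2), of "-1"]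
  by (metis (no_types, lifting) diff_conv_add_uminus ext mult_minus1 scaleR_minus1_left)

lemma integral_abs_le_norm_L2:
  assumes f: "square_integrable unit_interval f"
  shows "(\<integral>x. \<bar>f x\<bar> \<partial>unit_interval) \<le> norm (abs_L2 f)"
proof -
  have f': "square_integrable unit_interval (\<lambda>x. \<bar>f x\<bar>)"
    using f by (auto simp: square_integrable_def)
  have "norm (abs_L2 (\<lambda>x. 1)) = 1"
    using norm_abs_L2[OF square_integrable_one] integral_unit_interval_FTC[of "\<lambda>x. x" "\<lambda>x. 1"]
    by (simp add: power2_eq_1_iff) (smt (verit) norm_ge_zero)
  moreover have "(norm (abs_L2 (\<lambda>x. \<bar>f x\<bar>)))\<^sup>2 = (norm (abs_L2 f))\<^sup>2"
    by (simp add: norm_abs_L2 f f')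
  then have "norm (abs_L2 (\<lambda>x. \<bar>f x\<bar>)) = norm (abs_L2 f)" by simp
  ultimately show ?thesis
    using norm_cauchy_schwarz[of "abs_L2 (\<lambda>x. \<bar>f x\<bar>)" "abs_L2 (\<lambda>x. 1)"]
    by (simp add: inner_abs_L2[OF f' square_integrable_one])
qed

text \<open>Riesz-Fischer: on an interval of length 1 the L^2 norm dominates the L^1 norm, so a
  subsequence converges almost everywhere, and Fatou's lemma bounds the L^2 distance from its limit
  to the late terms.\<close>

instance L2 :: complete_space
proof
  fix X :: "nat \<Rightarrow> L2" assume X: "Cauchy X"
  define s where "s n = rep_L2 (X n)" for n
  have s: "square_integrable unit_interval (s n)" "abs_L2 (s n) = X n" for n
    by (auto simp: s_def square_integrable_rep_L2 abs_rep_L2)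
  have [measurable]: "s n \<in> borel_measurable unit_interval" for n
    using s by (simp add: square_integrable_def)
  have X_diff: "X i - X j = abs_L2 (\<lambda>x. s i x - s j x)" for i j
    using diff_abs_L2[OF s(1) s(1)] by (simp add: s(2))
  have "integrable unit_interval (s n)" for n
    using square_integrable_mult[OF s(1)[of n] square_integrable_one] by simp
  moreover have "\<exists>N. \<forall>i\<ge>N. \<forall>j\<ge>N. (\<integral>x. norm (s i x - s j x) \<partial>unit_interval) < e" if "e > 0" for e
  proof -
    obtain N where N: "\<And>i j. i \<ge> N \<Longrightarrow> j \<ge> N \<Longrightarrow> norm (X i - X j) < e"
      using CauchyD[OF X \<open>e > 0\<close>] by blast
    have "(\<integral>x. norm (s i x - s j x) \<partial>unit_interval) < e" if "i \<ge> N" "j \<ge> N" for i j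
      using integral_abs_le_norm_L2[OF square_integrable_diff[OF s(1)[of i] s(1)[of j]]] N[OF that]
      unfolding X_diff by simp
    then show ?thesis by blast
  qed
  ultimately obtain r where r: "strict_mono r" and "AE x in unit_interval. Cauchy (\<lambda>i. s (r i) x)"
    using cauchy_L1_AE_cauchy_subseq[of unit_interval s] by blast
  define f where "f x = lim (\<lambda>i. s (r i) x)" for x
  have [measurable]: "f \<in> borel_measurable unit_interval"
    unfolding f_def by measurable
  have ae: "AE x in unit_interval. (\<lambda>i. s (r i) x) \<longlonglongrightarrow> f x"
    using \<open>AE x in unit_interval. Cauchy _\<close>
    by eventually_elim (simp add: f_def Cauchy_convergent_iff convergent_LIMSEQ_iff)
  have nn: "(\<integral>\<^sup>+ x. ennreal ((s i x - s j x)\<^sup>2) \<partial>unit_interval) = ennreal ((norm (X i - X j))\<^sup>2)" for i j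
    using square_integrable_diff[OF s(1)[of i] s(1)[of j]]
    unfolding X_diff norm_abs_L2[OF square_integrable_diff[OF s(1)[of i] s(1)[of j]]]
    by (intro nn_integral_eq_integral) (auto simp: square_integrable_def)
  \<comment> \<open>Square integrability of \<open>f\<close> is still open here, so the estimate
    concerns f - s j; adding s N back gives it afterwards.\<close>
  have close: "square_integrable unit_interval (\<lambda>x. f x - s j x) \<and> norm (abs_L2 (\<lambda>x. f x - s j x)) \<le> e"
    if N: "\<And>i j. i \<ge> N \<Longrightarrow> j \<ge> N \<Longrightarrow> norm (X i - X j) < e" and j: "j \<ge> N" for e N j
  proof -
    have e: "e > 0" using N[OF j j] by simp
    have "(\<integral>\<^sup>+ x. ennreal ((f x - s j x)\<^sup>2) \<partial>unit_interval)
        = (\<integral>\<^sup>+ x. liminf (\<lambda>i. ennreal ((s (r i) x - s j x)\<^sup>2)) \<partial>unit_interval)"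
    proof (rule nn_integral_cong_AE)
      show "AE x in unit_interval. ennreal ((f x - s j x)\<^sup>2) = liminf (\<lambda>i. ennreal ((s (r i) x - s j x)\<^sup>2))"
        using ae
      proof eventually_elim
        case (elim x)
        have "(\<lambda>i. ennreal ((s (r i) x - s j x)\<^sup>2)) \<longlonglongrightarrow> ennreal ((f x - s j x)\<^sup>2)"
          using elim by (intro tendsto_intros)
        from lim_imp_Liminf[OF sequentially_bot this] show ?case by (rule sym)
      qed
    qed
    also have "\<dots> \<le> liminf (\<lambda>i. \<integral>\<^sup>+ x. ennreal ((s (r i) x - s j x)\<^sup>2) \<partial>unit_interval)"
      by (rule nn_integral_liminf) measurable
    also have "\<dots> \<le> ennreal (e\<^sup>2)"
    proof (rule Liminf_le)
      have "norm (X (r i) - X j) \<le> e" if "i \<ge> N" for i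
        using N[of "r i" j] j that seq_suble[OF r, of i] by simp
      then show "\<forall>\<^sub>F i in sequentially. (\<integral>\<^sup>+ x. ennreal ((s (r i) x - s j x)\<^sup>2) \<partial>unit_interval) \<le> ennreal (e\<^sup>2)"
        unfolding nn eventually_sequentially by (auto intro!: exI[of _ N] ennreal_leI power_mono)
    qed simp
    finally have le: "(\<integral>\<^sup>+ x. ennreal ((f x - s j x)\<^sup>2) \<partial>unit_interval) \<le> ennreal (e\<^sup>2)" .
    then have "integrable unit_interval (\<lambda>x. (f x - s j x)\<^sup>2)"
      by (intro integrableI_bounded) (auto simp: le_less_trans[OF le])
    then have sq: "square_integrable unit_interval (\<lambda>x. f x - s j x)"
      by (simp add: square_integrable_def)
    have "ennreal ((norm (abs_L2 (\<lambda>x. f x - s j x)))\<^sup>2) \<le> ennreal (e\<^sup>2)"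
      using le sq unfolding norm_abs_L2[OF sq]
      by (subst (asm) nn_integral_eq_integral) (auto simp: square_integrable_def)
    then have "(norm (abs_L2 (\<lambda>x. f x - s j x)))\<^sup>2 \<le> e\<^sup>2"
      by (simp add: ennreal_le_iff)
    then show ?thesis
      using sq e power2_le_imp_le by force
  qed
  obtain N where "\<And>i j. i \<ge> N \<Longrightarrow> j \<ge> N \<Longrightarrow> norm (X i - X j) < 1"
    using CauchyD[OF X, of 1] by auto
  from close[OF this order_refl] have "square_integrable unit_interval (\<lambda>x. f x - s N x)"
    by blast
  from square_integrable_add[OF this s(1)[of N]] have f: "square_integrable unit_interval f"
    by simp
  have "X \<longlonglongrightarrow> abs_L2 f"
  proof (rule LIMSEQ_I)
    fix e :: real assume e: "e > 0"
    obtain N where N: "\<And>i j. i \<ge> N \<Longrightarrow> j \<ge> N \<Longrightarrow> norm (X i - X j) < e / 2"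
      using CauchyD[OF X, of "e / 2"] e by auto
    have "norm (X j - abs_L2 f) < e" if "j \<ge> N" for j
    proof -
      have "norm (abs_L2 f - X j) \<le> e / 2"
        using close[OF N that] diff_abs_L2[OF f s(1)[of j]] by (simp add: s(2))
      then show ?thesis using e by (simp add: norm_minus_commute)
    qed
    then show "\<exists>no. \<forall>n\<ge>no. norm (X n - abs_L2 f) < e" by blast
  qed
  then show "convergent X" by (rule convergentI)
qed

text \<open>The positive and negative parts of f are densities of finite measures that agree on all
  half-lines. So the measures agree, and with them the densities.\<close>

lemma AE_eq_0_if_halfline_integrals_eq_0:
  fixes f :: "real \<Rightarrow> real"
  assumes f: "integrable lebesgue f"
    and zero: "\<And>t. (\<integral>x. f x * indicator {t<..} x \<partial>lebesgue) = 0"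
  shows "AE x in lebesgue. f x = 0"
proof -
  obtain g where g: "g \<in> borel_measurable borel" "AE x in lebesgue. f x = g x"
    using lebesgue_borel_representative[of f] f by auto
  have g_int: "integrable lborel g"
    using f lebesgue_integrable_representative(2)[OF g] by simp
  define M where "M h = density lborel (\<lambda>x. ennreal (h x))" for h :: "real \<Rightarrow> real"
  let ?p = "\<lambda>x. max 0 (g x)" and ?m = "\<lambda>x. max 0 (- g x)"
  have [measurable]: "g \<in> borel_measurable borel" by (rule g)
  have int: "integrable lborel (\<lambda>x. ?p x * indicator {t<..} x)" "integrable lborel (\<lambda>x. ?m x * indicator {t<..} x)" for t
    using g_int by (auto intro!: integrable_real_mult_indicator)
  have em: "emeasure (M ?p) {t<..} = ennreal (\<integral>x. ?p x * indicator {t<..} x \<partial>lborel)"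
    "emeasure (M ?m) {t<..} = ennreal (\<integral>x. ?m x * indicator {t<..} x \<partial>lborel)" for t
    using int[of t]
    by (auto simp: M_def emeasure_density ennreal_mult'' ennreal_indicator
        intro!: nn_integral_eq_integral[THEN trans[rotated]] nn_integral_cong)
  have "M ?p = M ?m"
  proof (rule measure_eqI_lessThan)
    fix t
    have "(\<lambda>x. g x * indicator {t<..} x) \<in> borel_measurable borel" by measurable
    moreover have "AE x in lebesgue. f x * indicator {t<..} x = g x * indicator {t<..} x"
      using g(2) by eventually_elim simp
    ultimately have "(\<integral>x. g x * indicator {t<..} x \<partial>lborel) = 0"
      using lebesgue_integrable_representative(3) zero[of t] by metis
    moreover have "(\<integral>x. ?p x * indicator {t<..} x \<partial>lborel) - (\<integral>x. ?m x * indicator {t<..} x \<partial>lborel)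
        = (\<integral>x. g x * indicator {t<..} x \<partial>lborel)"
      by (subst Bochner_Integration.integral_diff[symmetric, OF int])
        (auto intro!: Bochner_Integration.integral_cong simp: max_def indicator_def)
    ultimately show "emeasure (M ?p) {t<..} = emeasure (M ?m) {t<..}"
      unfolding em by simp
    show "emeasure (M ?p) {t<..} < \<infinity>" unfolding em by simp
  qed (auto simp: M_def)
  then have "AE x in lborel. ennreal (?p x) = ennreal (?m x)"
    unfolding M_def by (subst (asm) sigma_finite_measure.density_unique_iff[OF lborel.sigma_finite_measure_axioms]) auto
  then have "AE x in lborel. g x = 0"
    by eventually_elim (auto simp: max_def split: if_splits)
  then show ?thesis
    using g(2) unfolding AE_completion_iff by eventually_elim simp
qed

text \<open>Continuous ramps converge pointwise to the indicator of a half-line, so dominated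
  convergence reduces the claim to half-lines.\<close>

lemma AE_eq_0_if_orthogonal_to_continuous:
  fixes f :: "real \<Rightarrow> real"
  assumes f: "integrable unit_interval f"
    and zero: "\<And>h. continuous_on UNIV h \<Longrightarrow> (\<integral>x. f x * h x \<partial>unit_interval) = 0"
  shows "AE x in unit_interval. f x = 0"
proof -
  let ?f = "\<lambda>x. indicator {0<..<1} x * f x"
  have "AE x in lebesgue. ?f x = 0"
  proof (rule AE_eq_0_if_halfline_integrals_eq_0)
    show "integrable lebesgue ?f" using f by (simp add: integrable_unit_interval(1))
    fix t :: real
    define h where "h n x = max 0 (min 1 (real n * (x - t)))" for n x
    have h_cont: "continuous_on UNIV (h n)" for n
      unfolding h_def by (intro continuous_intros)
    have meas: "g \<in> borel_measurable unit_interval" if "g \<in> borel_measurable borel" for g :: "real \<Rightarrow> real"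
      using that by (intro measurable_restrict_space1 measurable_completion) simp
    have h_meas: "h n \<in> borel_measurable unit_interval" for n
      by (rule meas[OF borel_measurable_continuous_onI[OF h_cont]])
    have ind_meas: "(indicator {t<..} :: real \<Rightarrow> real) \<in> borel_measurable unit_interval"
      by (rule meas) simp
    have "(\<lambda>n. \<integral>x. f x * h n x \<partial>unit_interval) \<longlonglongrightarrow> (\<integral>x. f x * indicator {t<..} x \<partial>unit_interval)"
    proof (rule integral_dominated_convergence)
      show "integrable unit_interval (\<lambda>x. \<bar>f x\<bar>)" using f by simp
      show "AE x in unit_interval. norm (f x * h n x) \<le> \<bar>f x\<bar>" for n
        by (auto simp: h_def abs_mult intro!: mult_left_le)
      show "AE x in unit_interval. (\<lambda>n. f x * h n x) \<longlonglongrightarrow> f x * indicator {t<..} x"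
      proof (intro AE_I2 tendsto_mult tendsto_const)
        fix x
        show "(\<lambda>n. h n x) \<longlonglongrightarrow> indicator {t<..} x"
        proof (cases "x > t")
          case True
          then obtain N :: nat where N: "1 < real N * (x - t)"
            using reals_Archimedean3[of "x - t"] by auto
          have "h n x = 1" if "n \<ge> N" for n
          proof -
            have "real N * (x - t) \<le> real n * (x - t)"
              using that True by (intro mult_right_mono) auto
            then show ?thesis using N by (simp add: h_def)
          qed
          then have "\<forall>\<^sub>F n in sequentially. h n x = indicator {t<..} x"
            using True by (auto simp: eventually_sequentially)
          then show ?thesis by (rule tendsto_eventually)
        next
          case False
          then have "real n * (x - t) \<le> 0" for n by (intro mult_nonneg_nonpos) auto
          then have "h n x = indicator {t<..} x" for n
            using False by (simp add: h_def min.coboundedI2)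
          then show ?thesis by simp
        qed
      qed
    qed (use f h_meas ind_meas in \<open>auto intro!: borel_measurable_times\<close>)
    moreover have "(\<integral>x. f x * h n x \<partial>unit_interval) = 0" for n
      by (rule zero[OF h_cont])
    ultimately have "(\<integral>x. f x * indicator {t<..} x \<partial>unit_interval) = 0"
      by (simp add: LIMSEQ_const_iff)
    then show "(\<integral>x. ?f x * indicator {t<..} x \<partial>lebesgue) = 0"
      by (simp add: integrable_unit_interval(2) mult.assoc)
  qed
  then show ?thesis
    unfolding AE_unit_interval by eventually_elim (auto simp: indicator_def)
qed

section \<open>The sine system is an orthonormal basis\<close>

lemma sin_freq [simp]: "sin (freq n * pi) = 0"
  unfolding freq_def by (rule sin_npi)

definition sine :: "nat \<Rightarrow> real \<Rightarrow> real" where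
  "sine n x = sqrt 2 * sin (freq n * pi * x)"

definition sine_basis :: "nat \<Rightarrow> L2" where
  "sine_basis n = abs_L2 (sine n)"

lemma continuous_sine [continuous_intros]: "continuous_on A (sine n)"
  unfolding sine_def by (intro continuous_intros)

lemma square_integrable_sine: "square_integrable unit_interval (sine n)"
  by (intro square_integrable_continuous continuous_intros)

lemma inner_sine_basis:
  "square_integrable unit_interval f \<Longrightarrow> inner (abs_L2 f) (sine_basis n) = (\<integral>x. f x * sine n x \<partial>unit_interval)"
  by (simp add: sine_basis_def inner_abs_L2 square_integrable_sine)

text \<open>By the Chebyshev recursion \<open>f\<close> is orthogonal to \<open>sin (\<pi> x) p(cos (\<pi> x))\<close> for every polynomial
  \<open>p\<close>, and the functions \<open>p(cos (\<pi> x))\<close> are uniformly dense.\<close>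

lemma sine_total:
  assumes f: "square_integrable unit_interval f"
    and zero: "\<And>n. (\<integral>x. f x * sine n x \<partial>unit_interval) = 0"
  shows "AE x in unit_interval. f x = 0"
proof -
  have int: "integrable unit_interval (\<lambda>x. f x * g x)" if "continuous_on {0..1} g" for g
    using square_integrable_mult[OF f square_integrable_continuous[OF that]] .
  \<comment> \<open>Induction on m by 2 sin(k t) cos t = sin((k+1) t) + sin((k-1) t). The case k =
    0, where the integrand is 0, is included because the recursion lowers k.\<close>
  have power: "(\<integral>x. f x * (sin (real k * pi * x) * cos (pi * x) ^ m) \<partial>unit_interval) = 0" for k m
  proof (induction m arbitrary: k)
    case 0
    show ?case
    proof (cases k)
      case (Suc n)
      have "(\<integral>x. f x * sine n x \<partial>unit_interval) = sqrt 2 * (\<integral>x. f x * sin (real k * pi * x) \<partial>unit_interval)"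
        by (subst integral_mult_right_zero[symmetric]) (simp add: sine_def freq_def Suc mult_ac)
      then show ?thesis using zero[of n] by simp
    qed simp
  next
    case (Suc m)
    show ?case
    proof (cases k)
      case (Suc n)
      let ?s = "\<lambda>k x. f x * (sin (real k * pi * x) * cos (pi * x) ^ m)"
      have "f x * (sin (real k * pi * x) * cos (pi * x) ^ Suc m) = (?s (k + 1) x + ?s (k - 1) x) / 2" for x
      proof -
        have e: "real (k + 1) * pi * x = real k * pi * x + pi * x" "real (k - 1) * pi * x = real k * pi * x - pi * x"
          by (simp_all add: Suc algebra_simps)
        show ?thesis
          unfolding e sin_add sin_diff by (simp add: algebra_simps)
      qed
      then have "(\<integral>x. f x * (sin (real k * pi * x) * cos (pi * x) ^ Suc m) \<partial>unit_interval)
          = (\<integral>x. (?s (k + 1) x + ?s (k - 1) x) / 2 \<partial>unit_interval)"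
        by (intro Bochner_Integration.integral_cong refl)
      also have "\<dots> = ((\<integral>x. ?s (k + 1) x \<partial>unit_interval) + (\<integral>x. ?s (k - 1) x \<partial>unit_interval)) / 2"
        by (subst integral_divide_zero, subst Bochner_Integration.integral_add)
          (auto intro!: int continuous_intros)
      also have "\<dots> = 0" by (simp only: Suc.IH) simp
      finally show ?thesis .
    qed simp
  qed
  have poly: "(\<integral>x. f x * (sin (pi * x) * p (cos (pi * x))) \<partial>unit_interval) = 0"
    if "real_polynomial_function p" for p
  proof -
    obtain a N where p: "p = (\<lambda>t. \<Sum>i\<le>N. a i * t ^ i)"
      using \<open>real_polynomial_function p\<close> by (auto simp: real_polynomial_function_iff_sum)
    have "(\<integral>x. f x * (sin (pi * x) * p (cos (pi * x))) \<partial>unit_interval)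
        = (\<integral>x. (\<Sum>i\<le>N. a i * (f x * (sin (real 1 * pi * x) * cos (pi * x) ^ i))) \<partial>unit_interval)"
      unfolding p by (simp add: sum_distrib_left mult_ac)
    also have "\<dots> = (\<Sum>i\<le>N. \<integral>x. a i * (f x * (sin (real 1 * pi * x) * cos (pi * x) ^ i)) \<partial>unit_interval)"
      by (intro Bochner_Integration.integral_sum integrable_mult_right int continuous_intros)
    also have "\<dots> = 0"
      by (subst integral_mult_right_zero, subst power) simp
    finally show ?thesis .
  qed
  have "AE x in unit_interval. f x * sin (pi * x) = 0"
  proof (rule AE_eq_0_if_orthogonal_to_continuous)
    show "integrable unit_interval (\<lambda>x. f x * sin (pi * x))"
      by (intro int continuous_intros)
    fix h :: "real \<Rightarrow> real" assume h: "continuous_on UNIV h"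
    \<comment> \<open>The substitution t = cos(pi x) is invertible on [0,1], so h x = g (cos (pi x))
      there with g continuous on [-1,1], where Weierstrass approximation applies.\<close>
    define g where "g t = h (arccos t / pi)" for t
    have g: "continuous_on {-1..1} g"
      unfolding g_def by (intro continuous_on_compose2[OF h] continuous_intros continuous_on_arccos') auto
    have f_int: "integrable unit_interval f" using int[of "\<lambda>_. 1"] by simp
    let ?I = "\<integral>x. f x * sin (pi * x) * h x \<partial>unit_interval" and ?B = "\<integral>x. \<bar>f x\<bar> \<partial>unit_interval"
    have "\<bar>?I\<bar> \<le> e * ?B" if e: "e > 0" for e
    proof -
      obtain p where p: "real_polynomial_function p" "\<And>t. t \<in> {-1..1} \<Longrightarrow> \<bar>g t - p t\<bar> < e"
        using Stone_Weierstrass_real_polynomial_function[OF compact_Icc g e] by blast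
      have "continuous_on UNIV p"
        by (rule continuous_on_polymonial_function) (use p(1) in \<open>simp add: real_polynomial_function_eq\<close>)
      then have p_cont: "continuous_on A (\<lambda>x. p (cos (pi * x)))" for A
        by (rule continuous_on_compose2) (intro continuous_intros, simp)
      have ints: "integrable unit_interval (\<lambda>x. f x * (sin (pi * x) * h x))"
        "integrable unit_interval (\<lambda>x. f x * (sin (pi * x) * p (cos (pi * x))))"
        by (intro int continuous_intros p_cont continuous_on_subset[OF h subset_UNIV])+
      have "?I = ?I - (\<integral>x. f x * (sin (pi * x) * p (cos (pi * x))) \<partial>unit_interval)"
        by (simp add: poly[OF p(1)])
      also have "\<dots> = (\<integral>x. f x * (sin (pi * x) * h x) - f x * (sin (pi * x) * p (cos (pi * x))) \<partial>unit_interval)"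
        using ints by (simp add: mult.assoc)
      finally have I: "?I = (\<integral>x. f x * (sin (pi * x) * h x) - f x * (sin (pi * x) * p (cos (pi * x))) \<partial>unit_interval)" .
      have "\<bar>?I\<bar> \<le> (\<integral>x. e * \<bar>f x\<bar> \<partial>unit_interval)"
        unfolding I
      proof (rule integral_abs_bound_integral)
        fix x assume "x \<in> space unit_interval"
        then have x: "0 < x" "x < 1" by auto
        then have "h x = g (cos (pi * x))"
          by (simp add: g_def arccos_cos)
        then have "\<bar>h x - p (cos (pi * x))\<bar> \<le> e"
          using p(2)[of "cos (pi * x)"] by simp
        then have "\<bar>sin (pi * x)\<bar> * \<bar>h x - p (cos (pi * x))\<bar> \<le> 1 * e"
          by (intro mult_mono) auto
        then have "\<bar>f x\<bar> * (\<bar>sin (pi * x)\<bar> * \<bar>h x - p (cos (pi * x))\<bar>) \<le> \<bar>f x\<bar> * e"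
          by (intro mult_left_mono) auto
        moreover have "f x * (sin (pi * x) * h x) - f x * (sin (pi * x) * p (cos (pi * x)))
            = f x * (sin (pi * x) * (h x - p (cos (pi * x))))"
          by (simp add: right_diff_distrib)
        ultimately show "\<bar>f x * (sin (pi * x) * h x) - f x * (sin (pi * x) * p (cos (pi * x)))\<bar> \<le> e * \<bar>f x\<bar>"
          unfolding abs_mult by (simp only: abs_mult mult.commute[of e])
      qed (use ints f_int in auto)
      then show ?thesis by simp
    qed
    then have "\<forall>\<^sub>F e in at_right 0. \<bar>?I\<bar> \<le> e * ?B"
      by (intro eventually_mono[OF eventually_at_right_less]) auto
    moreover have "((\<lambda>e. e * ?B) \<longlongrightarrow> 0 * ?B) (at_right 0)"
      by (intro tendsto_intros)
    ultimately have "\<bar>?I\<bar> \<le> 0 * ?B"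
      by (intro tendsto_lowerbound) auto
    then show "?I = 0" by simp
  qed
  \<comment> \<open>Inside the interval sin(pi x) is positive and can be divided out.\<close>
  moreover have "AE x in unit_interval. 0 < x \<and> x < 1"
    by (simp add: AE_unit_interval)
  ultimately show ?thesis
  proof eventually_elim
    case (elim x)
    then show ?case using sin_gt_zero[of "pi * x"] by auto
  qed
qed

interpretation sine_basis: orthonormal_basis sine_basis
proof
  fix i j
  let ?d = "\<lambda>x. sin ((freq i - freq j) * pi * x) / ((freq i - freq j) * pi)"
  let ?s = "\<lambda>x. sin ((freq i + freq j) * pi * x) / ((freq i + freq j) * pi)"
  have sum: "freq i + freq j > 0" using freq_pos[of i] freq_pos[of j] by simp
  have prod: "sine i x * sine j x = cos ((freq i - freq j) * pi * x) - cos ((freq i + freq j) * pi * x)" for x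
    by (simp add: sine_def left_diff_distrib distrib_right cos_diff cos_add)
  have vanish: "sin (freq i * pi + freq j * pi) = 0" "sin (freq i * pi - freq j * pi) = 0"
    by (simp_all add: sin_add sin_diff)
  have "inner (sine_basis i) (sine_basis j) = (\<integral>x. sine i x * sine j x \<partial>unit_interval)"
    using inner_sine_basis[OF square_integrable_sine] by (simp add: sine_basis_def)
  also have "\<dots> = (if i = j then 1 else 0)"
  proof (cases "i = j")
    case True
    \<comment> \<open>For i = j the first cosine is constantly 1, so its primitive is x in place of
      \<open>?d\<close>.\<close>
    have "((\<lambda>x. x - ?s x) has_real_derivative sine i x * sine j x) (at x)" for x
      unfolding prod using sum True by (auto intro!: derivative_eq_intros)
    then have "(\<integral>x. sine i x * sine j x \<partial>unit_interval) = (1 - ?s 1) - (0 - ?s 0)"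
      by (rule integral_unit_interval_FTC) (simp add: prod)
    then show ?thesis using True vanish by (simp add: distrib_right mult_ac)
  next
    case False
    then have "freq i - freq j \<noteq> 0" by (simp add: freq_eq_iff)
    then have "((\<lambda>x. ?d x - ?s x) has_real_derivative sine i x * sine j x) (at x)" for x
      unfolding prod using sum by (auto intro!: derivative_eq_intros)
    then have "(\<integral>x. sine i x * sine j x \<partial>unit_interval) = (?d 1 - ?s 1) - (?d 0 - ?s 0)"
      by (rule integral_unit_interval_FTC) (simp add: prod)
    then show ?thesis using False vanish by (simp add: distrib_right left_diff_distrib)
  qed
  finally show "inner (sine_basis i) (sine_basis j) = (if i = j then 1 else 0)" .
next
  fix v assume v: "\<And>n. inner v (sine_basis n) = 0"
  have "(\<integral>x. rep_L2 v x * sine n x \<partial>unit_interval) = 0" for n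
    using v[of n] inner_sine_basis[OF square_integrable_rep_L2[of v], of n] by (simp add: abs_rep_L2)
  then have "AE x in unit_interval. rep_L2 v x = 0"
    by (intro sine_total square_integrable_rep_L2)
  then have "(\<integral>x. rep_L2 v x * rep_L2 v x \<partial>unit_interval) = 0"
    by (intro integral_eq_zero_AE) auto
  then show "v = 0" by (simp flip: inner_rep_L2)
qed

section \<open>Test functions in product form\<close>

text \<open>On a nondegenerate box derivatives relative to the box are unique even at the boundary.
  This determines \<open>pdx\<close> and \<open>pdy\<close>, whose underlying
  \<open>frechet_derivative\<close> is defined by choice.\<close>

lemma closed_square_eq_cbox: "closed_square = cbox (0, 0) (1, 1)"
  by (auto simp: cbox_Pair_eq)

lemma has_derivative_product:
  fixes f g :: "real \<Rightarrow> real"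
  assumes "(f has_real_derivative f') (at (fst p))" "(g has_real_derivative g') (at (snd p))"
  shows "((\<lambda>q. f (fst q) * g (snd q)) has_derivative
      (\<lambda>h. f (fst p) * (g' * snd h) + f' * fst h * g (snd p))) (at p within S)"
proof -
  have "((\<lambda>q. f (fst q)) has_derivative (\<lambda>h. f' * fst h)) (at p within S)"
    using has_derivative_compose[of fst fst p S f "\<lambda>h. f' * h"] assms(1)
    by (simp add: has_field_derivative_def bounded_linear_imp_has_derivative bounded_linear_fst)
  moreover have "((\<lambda>q. g (snd q)) has_derivative (\<lambda>h. g' * snd h)) (at p within S)"
    using has_derivative_compose[of snd snd p S g "\<lambda>h. g' * h"] assms(2)
    by (simp add: has_field_derivative_def bounded_linear_imp_has_derivative bounded_linear_snd)
  ultimately show ?thesis by (rule has_derivative_mult)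
qed

text \<open>A tower of successive derivatives stands for a smooth function of one variable.\<close>

definition derivative_tower :: "(nat \<Rightarrow> real \<Rightarrow> real) \<Rightarrow> bool" where
  "derivative_tower f \<longleftrightarrow> (\<forall>i x. (f i has_real_derivative f (Suc i) x) (at x))"

lemma derivative_tower_continuous: "derivative_tower f \<Longrightarrow> continuous_on A (f i)"
  unfolding derivative_tower_def by (meson DERIV_isCont continuous_at_imp_continuous_on)

context
  fixes f g :: "nat \<Rightarrow> real \<Rightarrow> real"
  assumes f: "derivative_tower f" and g: "derivative_tower g"
begin

lemma product_has_derivative:
  assumes F: "\<And>p. p \<in> closed_square \<Longrightarrow> F p = f i (fst p) * g j (snd p)" and p: "p \<in> closed_square"
  shows "(F has_derivative (\<lambda>h. f i (fst p) * (g (Suc j) (snd p) * snd h) + f (Suc i) (fst p) * fst h * g j (snd p)))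
      (at p within closed_square)"
  using has_derivative_product[of "f i" "f (Suc i) (fst p)" p "g j" "g (Suc j) (snd p)" closed_square] f g
  by (intro has_derivative_transform[OF p F]) (auto simp: derivative_tower_def)

lemma frechet_derivative_product:
  assumes F: "\<And>p. p \<in> closed_square \<Longrightarrow> F p = f i (fst p) * g j (snd p)" and p: "p \<in> closed_square"
  shows "frechet_derivative F (at p within closed_square) =
      (\<lambda>h. f i (fst p) * (g (Suc j) (snd p) * snd h) + f (Suc i) (fst p) * fst h * g j (snd p))"
  using product_has_derivative[OF F p] p unfolding closed_square_eq_cbox
  by (intro frechet_derivative_within_cbox) (auto simp: Basis_prod_def)

lemma dx_product:
  assumes "\<And>p. p \<in> closed_square \<Longrightarrow> F p = f i (fst p) * g j (snd p)" "p \<in> closed_square"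
  shows "dx F p = f (Suc i) (fst p) * g j (snd p)"
  using frechet_derivative_product[OF assms] by (simp add: pdx_def)

lemma dy_product:
  assumes "\<And>p. p \<in> closed_square \<Longrightarrow> F p = f i (fst p) * g j (snd p)" "p \<in> closed_square"
  shows "dy F p = f i (fst p) * g (Suc j) (snd p)"
  using frechet_derivative_product[OF assms] by (simp add: pdy_def)

lemma funpow_dx_product:
  "p \<in> closed_square \<Longrightarrow> (dx ^^ m) (\<lambda>p. f 0 (fst p) * g 0 (snd p)) p = f m (fst p) * g 0 (snd p)"
  by (induction m arbitrary: p) (auto intro!: dx_product)

lemma funpow_dy_product:
  "p \<in> closed_square \<Longrightarrow> (dy ^^ m) (\<lambda>p. f 0 (fst p) * g 0 (snd p)) p = f 0 (fst p) * g m (snd p)"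
  by (induction m arbitrary: p) (auto intro!: dy_product)

lemma Ck_on_product:
  "(\<And>p. p \<in> closed_square \<Longrightarrow> F p = f i (fst p) * g j (snd p)) \<Longrightarrow> Ck_on n closed_square F"
proof (induction n arbitrary: F i j)
  case 0
  have "continuous_on closed_square (\<lambda>p. f i (fst p) * g j (snd p))"
    by (intro continuous_intros continuous_on_compose2[OF derivative_tower_continuous[OF f, of UNIV]]
        continuous_on_compose2[OF derivative_tower_continuous[OF g, of UNIV]]) auto
  then show ?case using 0 by (simp cong: continuous_on_cong)
next
  case (Suc n)
  have "F differentiable_on closed_square"
    unfolding differentiable_on_def differentiable_def using product_has_derivative[OF Suc.prems] by blast
  moreover have "Ck_on n closed_square (dx F)" "Ck_on n closed_square (dy F)"
    using dx_product[OF Suc.prems] dy_product[OF Suc.prems] by (auto intro!: Suc.IH)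
  ultimately show ?case by simp
qed

lemma product_in_kernel_tests:
  assumes "f 0 0 = 0" "f 0 1 = 0" "f 1 0 = 0" "f 2 0 = 0" "f 2 1 = 0" "g 0 0 = 0" "g 0 1 = 0" "g 2 1 = 0"
  shows "(\<lambda>p. f 0 (fst p) * g 0 (snd p)) \<in> kernel_tests"
proof -
  let ?F = "\<lambda>p. f 0 (fst p) * g 0 (snd p)"
  have dx1: "dx ?F p = f 1 (fst p) * g 0 (snd p)" if "p \<in> closed_square" for p
    using dx_product[of ?F 0 0, OF refl that] by simp
  have dx2: "dx (dx ?F) p = f 2 (fst p) * g 0 (snd p)" if "p \<in> closed_square" for p
    using dx_product[of "dx ?F" 1 0, OF dx1 that] by (simp add: numeral_2_eq_2)
  have dy1: "dy ?F p = f 0 (fst p) * g 1 (snd p)" if "p \<in> closed_square" for p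
    using dy_product[of ?F 0 0, OF refl that] by simp
  have dy2: "dy (dy ?F) p = f 0 (fst p) * g 2 (snd p)" if "p \<in> closed_square" for p
    using dy_product[of "dy ?F" 0 1, OF dy1 that] by (simp add: numeral_2_eq_2)
  have "smooth_on closed_square ?F"
    unfolding smooth_on_def using Ck_on_product[of ?F 0 0] by blast
  then show ?thesis
    unfolding kernel_tests_def by (simp add: dx1 dx2 dy2 assms[simplified])
qed

end

section \<open>Sine modes and the equations they yield\<close>

definition sine_tower :: "nat \<Rightarrow> nat \<Rightarrow> real \<Rightarrow> real" where
  "sine_tower n i x = sqrt 2 * (freq n * pi) ^ i * sin (freq n * pi * x + real i * (pi / 2))"

lemma derivative_tower_sine: "derivative_tower (sine_tower n)"
  unfolding derivative_tower_def sine_tower_def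
proof (intro allI)
  fix i x
  have shift: "freq n * pi * x + real (Suc i) * (pi / 2) = (freq n * pi * x + real i * (pi / 2)) + pi / 2"
    by (simp add: field_simps)
  have "sin (freq n * pi * x + real (Suc i) * (pi / 2)) = cos (freq n * pi * x + real i * (pi / 2))"
    unfolding shift by (simp only: sin_add[of _ "pi / 2"] sin_pi_half cos_pi_half mult_zero_right mult_1_right add_0_left)
  then show "((\<lambda>x. sqrt 2 * (freq n * pi) ^ i * sin (freq n * pi * x + real i * (pi / 2))) has_real_derivative
      sqrt 2 * (freq n * pi) ^ Suc i * sin (freq n * pi * x + real (Suc i) * (pi / 2))) (at x)"
    by (auto intro!: derivative_eq_intros)
qed

lemma sine_tower_simps:
  "sine_tower n 0 x = sine n x"
  "sine_tower n 1 0 = sqrt 2 * (freq n * pi)"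
  "sine_tower n 2 x = - ((freq n * pi)\<^sup>2 * sine n x)"
  "sine_tower n 4 x = (freq n * pi) ^ 4 * sine n x"
  by (simp_all add: sine_tower_def sine_def)

lemma sine_0_1 [simp]: "sine n 0 = 0" "sine n 1 = 0"
  by (simp_all add: sine_def)

lemma sine_tower_operator: "sine_tower n 4 x + lam * sine_tower n 2 x = eigval lam n * sine n x"
  by (simp add: sine_tower_simps eigval_def power_mult_distrib algebra_simps)

lemma derivative_tower_scale: "derivative_tower f \<Longrightarrow> derivative_tower (\<lambda>i x. c * f i x)"
  unfolding derivative_tower_def by (auto intro!: derivative_eq_intros)

lemma derivative_tower_diff:
  "derivative_tower f \<Longrightarrow> derivative_tower g \<Longrightarrow> derivative_tower (\<lambda>i x. f i x - g i x)"
  unfolding derivative_tower_def by (auto intro!: derivative_eq_intros)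

text \<open>\<open>sin (n \<pi> x) / n - sin (\<pi> x)\<close> has vanishing first derivative at \<open>0\<close>, as test functions must.\<close>

lemma kernel_solution_modes:
  assumes k: "kernel_solution lam a k" and g: "derivative_tower g"
    and bc: "g 0 0 = 0" "g 0 1 = 0" "g 2 1 = 0"
  defines "K \<equiv> integral_operator k"
    and "u \<equiv> abs_L2 (g 0)" and "Au \<equiv> abs_L2 (\<lambda>y. g 4 y + lam * g 2 y)"
  shows "((eigval lam n + a) * inner (K u) (sine_basis n) - inner (K Au) (sine_basis n)
        - a * inner u (sine_basis n)) / freq n
      = ((eigval lam 0 + a) * inner (K u) (sine_basis 0) - inner (K Au) (sine_basis 0)
        - a * inner u (sine_basis 0)) / freq 0"
proof -
  have sol: "(\<integral>p. ((dx ^^ 4) \<rho> p + lam * (dx ^^ 2) \<rho> p - (dy ^^ 4) \<rho> p - lam * (dy ^^ 2) \<rho> p + a * \<rho> p) * k p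
           \<partial>unit_square) = (\<integral>x. a * \<rho> (x, x) \<partial>unit_interval)" if "\<rho> \<in> kernel_tests" for \<rho>
    using k that by (simp add: kernel_solution_def)
  interpret L2_kernel k
    using k by unfold_locales (simp add: kernel_solution_def kernel_space_def sobolev_def)
  \<comment> \<open>The operator in y stays on \<open>g\<close>, which may be a sine or the cubic;
    the operator in x becomes multiplication by eigenvalues.\<close>
  define G where "G = (\<lambda>y. g 4 y + lam * g 2 y)"
  have sq: "square_integrable unit_interval (g 0)" "square_integrable unit_interval G"
    unfolding G_def by (intro square_integrable_continuous continuous_intros derivative_tower_continuous[OF g])+
  \<comment> \<open>Subtracting the lowest mode loses one equation for each \<open>g\<close>, so the
    conclusion only equates the n-th expression, divided by its frequency, with the 0-th.\<close>
  define f where "f i x = 1 / freq n * sine_tower n i x - 1 / freq 0 * sine_tower 0 i x" for i x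
  have f: "derivative_tower f"
    unfolding f_def by (intro derivative_tower_diff derivative_tower_scale derivative_tower_sine)
  have f0: "f 0 x = sine n x / freq n - sine 0 x / freq 0" for x
    by (simp only: f_def sine_tower_simps(1) times_divide_eq_left mult_1)
  define \<rho> where "\<rho> p = f 0 (fst p) * g 0 (snd p)" for p
  have "\<rho> \<in> kernel_tests"
    unfolding \<rho>_def using bc freq_pos[of n] freq_pos[of 0]
    by (intro product_in_kernel_tests[OF f g]) (auto simp: f_def sine_tower_simps sine_tower_simps(2)[unfolded One_nat_def])
  note eq = sol[OF this]
  define I where "I m h = (\<integral>p. k p * (sine m (fst p) * h (snd p)) \<partial>unit_square)" for m h
  have I: "inner (K (abs_L2 h)) (sine_basis m) = I m h" if "square_integrable unit_interval h" for m h
    unfolding K_def I_def sine_basis_def by (rule inner_integral_operator[OF square_integrable_sine that])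
  have int: "integrable unit_square (\<lambda>p. k p * (sine m (fst p) * h (snd p)))"
    if "square_integrable unit_interval h" for m h
    using square_integrable square_integrable_tensor[OF square_integrable_sine that]
    by (rule square_integrable_mult)
  have "(\<integral>p. ((dx ^^ 4) \<rho> p + lam * (dx ^^ 2) \<rho> p - (dy ^^ 4) \<rho> p - lam * (dy ^^ 2) \<rho> p + a * \<rho> p) * k p \<partial>unit_square)
      = (\<integral>p. ((eigval lam n + a) / freq n * (k p * (sine n (fst p) * g 0 (snd p)))
          - (eigval lam 0 + a) / freq 0 * (k p * (sine 0 (fst p) * g 0 (snd p))))
          - (1 / freq n * (k p * (sine n (fst p) * G (snd p)))
          - 1 / freq 0 * (k p * (sine 0 (fst p) * G (snd p)))) \<partial>unit_square)"
  proof (rule Bochner_Integration.integral_cong[OF refl])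
    fix p assume "p \<in> space unit_square"
    then have p: "p \<in> closed_square" by (cases p) (simp add: space_restrict_space)
    have fA: "f 4 x + lam * f 2 x = eigval lam n * sine n x / freq n - eigval lam 0 * sine 0 x / freq 0" for x
      unfolding sine_tower_operator[symmetric] f_def by (simp add: algebra_simps add_divide_distrib)
    have L: "(dx ^^ 4) \<rho> p + lam * (dx ^^ 2) \<rho> p - (dy ^^ 4) \<rho> p - lam * (dy ^^ 2) \<rho> p + a * \<rho> p
        = (f 4 (fst p) + lam * f 2 (fst p)) * g 0 (snd p) - f 0 (fst p) * G (snd p)
          + a * (f 0 (fst p) * g 0 (snd p))"
      unfolding \<rho>_def[abs_def] funpow_dx_product[OF f g p] funpow_dy_product[OF f g p]
      by (simp add: G_def algebra_simps)
    show "((dx ^^ 4) \<rho> p + lam * (dx ^^ 2) \<rho> p - (dy ^^ 4) \<rho> p - lam * (dy ^^ 2) \<rho> p + a * \<rho> p) * k p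
      = ((eigval lam n + a) / freq n * (k p * (sine n (fst p) * g 0 (snd p)))
          - (eigval lam 0 + a) / freq 0 * (k p * (sine 0 (fst p) * g 0 (snd p))))
          - (1 / freq n * (k p * (sine n (fst p) * G (snd p)))
          - 1 / freq 0 * (k p * (sine 0 (fst p) * G (snd p))))"
      unfolding L fA f0 by (simp add: algebra_simps add_divide_distrib)
  qed
  also have "\<dots> = ((eigval lam n + a) / freq n * I n (g 0) - (eigval lam 0 + a) / freq 0 * I 0 (g 0))
      - (1 / freq n * I n G - 1 / freq 0 * I 0 G)"
    unfolding I_def by (simp only: Bochner_Integration.integral_diff Bochner_Integration.integrable_diff
        integrable_mult_right integral_mult_right_zero int sq)
  finally have lhs: "(\<integral>x. a * \<rho> (x, x) \<partial>unit_interval) =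
      ((eigval lam n + a) / freq n * I n (g 0) - (eigval lam 0 + a) / freq 0 * I 0 (g 0))
      - (1 / freq n * I n G - 1 / freq 0 * I 0 G)"
    unfolding eq .
  have int1: "integrable unit_interval (\<lambda>x. g 0 x * sine m x)" for m
    using sq(1) square_integrable_sine by (rule square_integrable_mult)
  have "(\<integral>x. a * \<rho> (x, x) \<partial>unit_interval)
      = (\<integral>x. a / freq n * (g 0 x * sine n x) - a / freq 0 * (g 0 x * sine 0 x) \<partial>unit_interval)"
    by (intro Bochner_Integration.integral_cong refl) (simp add: \<rho>_def f0 algebra_simps)
  also have "\<dots> = a / freq n * inner u (sine_basis n) - a / freq 0 * inner u (sine_basis 0)"
    unfolding u_def inner_sine_basis[OF sq(1)]
    by (simp only: Bochner_Integration.integral_diff integrable_mult_right integral_mult_right_zero int1)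
  finally show ?thesis
    using lhs unfolding u_def Au_def G_def[symmetric] I[OF sq(1)] I[OF sq(2)]
    by (simp add: diff_divide_distrib add_divide_distrib algebra_simps)
qed

section \<open>Invertibility\<close>

text \<open>\<open>y (y - 1) (y - 2)\<close> vanishes at \<open>0\<close> and \<open>1\<close>, and its second derivative vanishes at \<open>1\<close> but not at \<open>0\<close>.\<close>

definition cubic_tower :: "nat \<Rightarrow> real \<Rightarrow> real" where
  "cubic_tower i y = (if i = 0 then y ^ 3 - 3 * y\<^sup>2 + 2 * y else if i = 1 then 3 * y\<^sup>2 - 6 * y + 2
     else if i = 2 then 6 * y - 6 else if i = 3 then 6 else 0)"

lemma derivative_tower_cubic: "derivative_tower cubic_tower"
  unfolding derivative_tower_def
proof (intro allI)
  fix i :: nat and x :: real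
  consider "i = 0" | "i = 1" | "i = 2" | "i = 3" | "i > 3" by linarith
  then show "(cubic_tower i has_real_derivative cubic_tower (Suc i) x) (at x)"
    by cases (auto simp: cubic_tower_def[abs_def] intro!: derivative_eq_intros)
qed

text \<open>Repeated integration by parts; the only surviving boundary term is the one with the
  second derivative -6 of the cubic at 0.\<close>

lemma inner_cubic_sine:
  "inner (abs_L2 (cubic_tower 0)) (sine_basis n) = 6 * sqrt 2 / (freq n * pi) ^ 3"
proof -
  define w where "w = freq n * pi"
  have w: "w \<noteq> 0" "sin w = 0" using freq_pos[of n] by (auto simp: w_def)
  have sine: "sine n y = sqrt 2 * sin (w * y)" for y by (simp add: sine_def w_def)
  let ?F = "\<lambda>y. sqrt 2 * (- (y ^ 3 - 3 * y\<^sup>2 + 2 * y) * cos (w * y) / w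
    + (3 * y\<^sup>2 - 6 * y + 2) * sin (w * y) / w\<^sup>2 + (6 * y - 6) * cos (w * y) / w ^ 3 - 6 * sin (w * y) / w ^ 4)"
  have F: "(?F has_real_derivative cubic_tower 0 y * sine n y) (at y)" for y
    using w by (auto intro!: derivative_eq_intros
        simp: cubic_tower_def sine field_simps power2_eq_square power3_eq_cube power4_eq_xxxx)
  have "(\<integral>y. cubic_tower 0 y * sine n y \<partial>unit_interval) = ?F 1 - ?F 0"
    by (rule integral_unit_interval_FTC[OF F]) (simp add: cubic_tower_def sine_def)
  moreover have "?F 1 - ?F 0 = 6 * sqrt 2 / w ^ 3"
    using w by simp
  ultimately show ?thesis
    unfolding w_def[symmetric]
    by (simp add: inner_sine_basis square_integrable_continuous derivative_tower_continuous derivative_tower_cubic)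
qed

text \<open>The fourth derivative is 0 and the second is 6 (y - 1), whose value at 0 gives the only
  boundary term.\<close>

lemma inner_linear_sine:
  "inner (abs_L2 (\<lambda>y. cubic_tower 4 y + lam * cubic_tower 2 y)) (sine_basis n) = - 6 * lam * sqrt 2 / (freq n * pi)"
proof -
  define w where "w = freq n * pi"
  have w: "w \<noteq> 0" "sin w = 0" using freq_pos[of n] by (auto simp: w_def)
  have sine: "sine n y = sqrt 2 * sin (w * y)" for y by (simp add: sine_def w_def)
  have lin: "cubic_tower 4 y + lam * cubic_tower 2 y = 6 * lam * (y - 1)" for y
    by (simp add: cubic_tower_def algebra_simps)
  let ?F = "\<lambda>y. 6 * lam * sqrt 2 * (- (y - 1) * cos (w * y) / w + sin (w * y) / w\<^sup>2)"
  have F: "(?F has_real_derivative (6 * lam * (y - 1)) * sine n y) (at y)" for y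
    using w by (auto intro!: derivative_eq_intros simp: sine field_simps power2_eq_square)
  have "(\<integral>y. (6 * lam * (y - 1)) * sine n y \<partial>unit_interval) = ?F 1 - ?F 0"
    by (rule integral_unit_interval_FTC[OF F]) (simp add: sine_def)
  moreover have "?F 1 - ?F 0 = - 6 * lam * sqrt 2 / w"
    using w by simp
  moreover have "square_integrable unit_interval (\<lambda>y. 6 * lam * (y - 1))"
    by (intro square_integrable_continuous continuous_intros)
  ultimately show ?thesis
    unfolding w_def[symmetric] lin by (simp add: inner_sine_basis)
qed

theorem theorem3p1:
  fixes lam a :: real and k :: "real \<times> real \<Rightarrow> real"
  assumes "lam > 0"
    and "lam \<notin> excluded_lambda"
    and "a \<notin> excluded_a lam"
    and "kernel_solution lam a k"
  shows "invertible_operator (\<lambda>v. v - integral_operator k v)"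
proof -
  interpret nonresonant lam a using assms by unfold_locales
  interpret L2_kernel k
    using assms(4) by unfold_locales (simp add: kernel_solution_def kernel_space_def sobolev_def)
  interpret swap: L2_kernel "\<lambda>p. k (prod.swap p)"
    by unfold_locales (rule square_integrable_swap[OF square_integrable])
  define K where "K = integral_operator k"
  define K' where "K' = integral_operator (\<lambda>p. k (prod.swap p))"
  define e where "e = sine_basis"
  have K: "bounded_linear K" "bounded_linear K'"
    unfolding K_def K'_def by (rule bounded_linear_integral_operator swap.bounded_linear_integral_operator)+
  interpret K: bounded_linear K by (rule K)
  interpret K': bounded_linear K' by (rule K)
  have adj: "inner (K x) y = inner x (K' y)" for x y
    unfolding K_def K'_def by (rule integral_operator_adjoint)
  have adj': "inner (K' x) y = inner x (K y)" for x y
    by (metis adj inner_commute)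
  have ortho: "inner (e i) (e j) = (if i = j then 1 else 0)" for i j
    unfolding e_def by (rule sine_basis.orthonormal)
  have HS: "summable (\<lambda>n. (norm (K (e n)))\<^sup>2)" "summable (\<lambda>n. (norm (K' (e n)))\<^sup>2)"
    unfolding K_def K'_def e_def
    by (rule summableI_nonneg_bounded, simp,
        rule sum_norm_integral_operator_le[where B = 1] swap.sum_norm_integral_operator_le[where B = 1],
        simp, simp add: sine_basis.Bessel)+
  define t where "t n j = inner (e j - K (e j)) (e n)" for n j
  have modes: "((\<mu> n + a) * inner (K (abs_L2 (g 0))) (e n)
        - inner (K (abs_L2 (\<lambda>y. g 4 y + lam * g 2 y))) (e n) - a * inner (abs_L2 (g 0)) (e n)) / freq n
      = ((\<mu> 0 + a) * inner (K (abs_L2 (g 0))) (e 0)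
        - inner (K (abs_L2 (\<lambda>y. g 4 y + lam * g 2 y))) (e 0) - a * inner (abs_L2 (g 0)) (e 0)) / freq 0"
    if "derivative_tower g" "g 0 0 = 0" "g 0 1 = 0" "g 2 1 = 0" for g n
    unfolding K_def e_def by (rule kernel_solution_modes[OF assms(4) that])
  \<comment> \<open>By \<open>modes\<close> with the j-th sine, (mu_n + a - mu_j) t n j / freq n
    does not depend on n; this is its value at n = 0.\<close>
  define c where "c j = (\<mu> 0 + a - \<mu> j) * t 0 j / freq 0" for j
  have t: "t n j = c j * freq n * entry n j" for n j
  proof -
    have sine0: "abs_L2 (sine_tower j 0) = e j"
      by (simp add: e_def sine_basis_def sine_tower_simps[abs_def])
    have sine4: "abs_L2 (\<lambda>y. sine_tower j 4 y + lam * sine_tower j 2 y) = \<mu> j *\<^sub>R e j"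
      unfolding sine_tower_operator e_def sine_basis_def by (rule scaleR_abs_L2[OF square_integrable_sine, symmetric])
    \<comment> \<open>The diagonal source term of the kernel problem is what turns K into I - K: at
      m = j the factor mu_m + a - mu_j equals a.\<close>
    have *: "(\<mu> m + a) * inner (K (e j)) (e m) - inner (K (\<mu> j *\<^sub>R e j)) (e m) - a * inner (e j) (e m)
        = - ((\<mu> m + a - \<mu> j) * t m j)" for m
      by (simp add: t_def K.scale inner_diff_left ortho algebra_simps)
    have "(\<mu> n + a - \<mu> j) * t n j / freq n = c j"
      using modes[OF derivative_tower_sine[of j], of n]
      unfolding sine0 sine4 * by (simp add: c_def sine_tower_simps)
    then show ?thesis
      using nonzero[of n j] freq_pos[of n] by (simp add: entry_def field_simps)
  qed
  \<comment> \<open>Row n of T is the coefficient sequence of (I - K') e_n, so Parseval expands the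
    n-th coordinate of (I - K) u.\<close>
  have t_sums: "(\<lambda>j. c j * freq n * entry n j * inner u (e j)) sums inner (u - K u) (e n)" for n u
  proof -
    have coeff: "inner (e n - K' (e n)) (e j) = c j * freq n * entry n j" for j
      unfolding t[symmetric] t_def by (simp add: inner_diff_left adj' inner_commute[of "e n"])
    have "(\<lambda>j. inner (e n - K' (e n)) (e j) * inner u (e j)) sums inner (e n - K' (e n)) u"
      unfolding e_def by (rule sine_basis.Parseval)
    then show ?thesis
      unfolding coeff by (simp add: inner_diff_left adj' inner_commute[of "e n"])
  qed
  obtain C where C: "\<And>n. (\<lambda>j. c j * ((\<mu> n + a) / freq j ^ 3 + lam * pi\<^sup>2 / freq j) * entry n j) sums C"
  proof -
    define \<alpha> where "\<alpha> = 6 * sqrt 2 / pi ^ 3"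
    have \<alpha>: "\<alpha> \<noteq> 0" by (simp add: \<alpha>_def)
    define q where "q = abs_L2 (cubic_tower 0)"
    define Aq where "Aq = abs_L2 (\<lambda>y. cubic_tower 4 y + lam * cubic_tower 2 y)"
    have q: "inner q (e j) = \<alpha> / freq j ^ 3" for j
      unfolding q_def e_def inner_cubic_sine by (simp add: \<alpha>_def power_mult_distrib)
    have Aq: "inner Aq (e j) = - (lam * pi\<^sup>2 * \<alpha> / freq j)" for j
      unfolding Aq_def e_def inner_linear_sine using freq_pos[of j]
      by (simp add: \<alpha>_def field_simps power2_eq_square power3_eq_cube)
    define X where "X = ((\<mu> 0 + a) * inner (K q) (e 0) - inner (K Aq) (e 0) - a * inner q (e 0)) / freq 0"
    have X: "(\<mu> n + a) * inner (K q) (e n) - inner (K Aq) (e n) - a * inner q (e n) = X * freq n" for n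
      using modes[OF derivative_tower_cubic, of n] freq_pos[of n]
      unfolding X_def q_def[symmetric] Aq_def[symmetric] by (simp add: cubic_tower_def field_simps)
    show thesis
    proof (rule that[of "(\<alpha> * pi ^ 4 - X) / \<alpha>"])
      fix n
      \<comment> \<open>Because the second derivative of q at 0 is nonzero, moving the operator from
        q to the sine leaves a boundary term. It is a multiple of freq n, as is the unknown X * freq
        n, so both merge into the constant C after division by alpha * freq n.\<close>
      have "\<mu> n * inner q (e n) - inner Aq (e n) = \<alpha> * pi ^ 4 * freq n"
        unfolding q Aq using freq_pos[of n]
        by (simp add: eigval_def field_simps power2_eq_square power3_eq_cube power4_eq_xxxx)
      then have rhs: "(\<mu> n + a) * inner (q - K q) (e n) - inner (Aq - K Aq) (e n) = (\<alpha> * pi ^ 4 - X) * freq n"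
        using X[of n] by (simp add: inner_diff_left algebra_simps)
      have "(\<lambda>j. ((\<mu> n + a) * (c j * freq n * entry n j * inner q (e j)) - c j * freq n * entry n j * inner Aq (e j)) / (\<alpha> * freq n))
          sums (((\<mu> n + a) * inner (q - K q) (e n) - inner (Aq - K Aq) (e n)) / (\<alpha> * freq n))"
        by (intro sums_divide sums_diff sums_mult t_sums)
      moreover have "((\<mu> n + a) * (c j * freq n * entry n j * inner q (e j)) - c j * freq n * entry n j * inner Aq (e j)) / (\<alpha> * freq n)
          = c j * ((\<mu> n + a) / freq j ^ 3 + lam * pi\<^sup>2 / freq j) * entry n j" for j
        unfolding q Aq using \<alpha> freq_pos[of n] freq_pos[of j] by (simp add: field_simps)
      ultimately show "(\<lambda>j. c j * ((\<mu> n + a) / freq j ^ 3 + lam * pi\<^sup>2 / freq j) * entry n j) sums ((\<alpha> * pi ^ 4 - X) / \<alpha>)"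
        unfolding rhs using freq_pos[of n] by simp
    qed
  qed
  \<comment> \<open>The j-th diagonal entry of T is both freq j * c j / a and 1 - <K e_j, e_j>, and
    norm (K e_j) tends to 0 by \<open>HS\<close>.\<close>
  have c_lim: "(\<lambda>j. freq j * c j) \<longlonglongrightarrow> a"
  proof -
    have eq: "freq j * c j = a * (1 - inner (K (e j)) (e j))" for j
      using t[of j j] a_nonzero by (simp add: t_def entry_def inner_diff_left ortho field_simps)
    have "(\<lambda>j. norm (K (e j))) \<longlonglongrightarrow> 0"
      using tendsto_real_sqrt[OF summable_LIMSEQ_zero[OF HS(1)]] by simp
    moreover have "\<bar>inner (K (e j)) (e j)\<bar> \<le> norm (K (e j))" for j
      using Cauchy_Schwarz_ineq2[of "K (e j)" "e j"] ortho[of j j] by (simp add: norm_eq_sqrt_inner)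
    ultimately have "(\<lambda>j. inner (K (e j)) (e j)) \<longlonglongrightarrow> 0"
      by (intro Lim_null_comparison[of "\<lambda>j. inner (K (e j)) (e j)" "\<lambda>j. norm (K (e j))"]) auto
    then have "(\<lambda>j. a * (1 - inner (K (e j)) (e j))) \<longlonglongrightarrow> a * (1 - 0)"
      by (intro tendsto_intros)
    then show ?thesis by (simp add: eq)
  qed
  interpret cauchy_system lam a c C
    by unfold_locales (use c_lim C in auto)
  have inj: "v = 0" if v: "v - K' v = 0" for v
  proof -
    define w where "w n = inner v (e n)" for n
    have "summable (\<lambda>n. \<bar>w n\<bar> / freq n)"
    proof (rule summable_comparison_test')
      show "summable (\<lambda>n. (w n)\<^sup>2 + 1 / (freq n)\<^sup>2)"
        unfolding w_def e_def
        by (intro summable_add sine_basis.summable_coeffs sums_summable[OF sums_inverse_freq_squared])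
      fix n
      have "2 * (\<bar>w n\<bar> * (1 / freq n)) \<le> (w n)\<^sup>2 + 1 / (freq n)\<^sup>2"
        using sum_squares_bound[of "\<bar>w n\<bar>" "1 / freq n"] by (simp add: power_divide)
      moreover have "0 \<le> \<bar>w n\<bar> / freq n" using freq_pos[of n] by simp
      ultimately show "norm (\<bar>w n\<bar> / freq n) \<le> (w n)\<^sup>2 + 1 / (freq n)\<^sup>2"
        by simp
    qed
    \<comment> \<open>Column j of T paired with w is <v, T e_j> = <T' v, e_j>, which
      vanishes.\<close>
    moreover have "(\<lambda>n. w n * freq n * (c j * entry n j)) sums 0" for j
    proof -
      have "(\<lambda>n. inner v (e n) * inner (e j - K (e j)) (e n)) sums inner v (e j - K (e j))"
        unfolding e_def by (rule sine_basis.Parseval)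
      moreover have "inner v (e j - K (e j)) = inner (e j) (v - K' v)"
        by (simp add: inner_diff_right inner_commute[of v] adj)
      ultimately show ?thesis
        unfolding t_def[symmetric] t w_def[symmetric] v by (simp add: mult_ac)
    qed
    ultimately have "annihilates w" by (simp add: annihilates_def)
    then have "inner v (sine_basis n) = 0" for n
      using annihilates_imp_0[of w n] by (simp add: w_def e_def)
    then show "v = 0" by (rule sine_basis.total)
  qed
  have "invertible_operator (\<lambda>v. v - K v)"
    using sine_basis.invertible_id_minus_Hilbert_Schmidt[OF K adj] HS inj unfolding e_def by blast
  then show ?thesis by (simp add: K_def)
qed

end
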